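(* Let $k$ be a positive integer and let $T\in\mathbb{M}_k$ be a $k\times k$ complex matrix. Then for every positive integer $n$, $$\omega(T)=\frac{1}{n}\,\omega^n(T),\qquad\text{where}\quad \omega^n(T)=\sup\{\|X\|_1 \;:\; X\in W^n(T)\}.$$
   Context: $\mathbb{M}_n=\mathbb{M}_n(\mathbb{C})$ is the algebra of $n\times n$ complex matrices with identity $I_n$; $\mathbb{M}_k$ is identified with the bounded linear operators on $\mathbb{C}^k$ with its standard inner product. For $X\in\mathbb{M}_n$, $|X|=(X^*X)^{1/2}$ and $\|X\|_1=\mathrm{Tr}\,|X|$, where $\mathrm{Tr}$ is the canonical (unnormalized) trace. The numerical radius of $T$ is $\omega(T)=\sup\{|\langle Tx,x\rangle| : \|x\|=1\}$. $C^*(T)$ denotes the unital $C^*$-algebra generated by $T$ (and the identity operator). A linear map $\Phi:\mathscr{A}\to\mathscr{B}$ between unital $C^*$-algebras is completely positive if for every $m\in\mathbb{N}$ the map $[A_{ij}]\mapsto[\Phi(A_{ij})]$ from $\mathbb{M}_m(\mathscr{A})$ to $\mathbb{M}_m(\mathscr{B})$ sends positive elements to positive elements. $CP_n(T)$ is the set of all unital completely positive linear maps $\Phi:C^*(T)\to\mathbb{M}_n$, and the $n$'th matricial range of $T$ is $W^n(T)=\{\Phi(T) : \Phi\in CP_n(T)\}\subseteq\mathbb{M}_n$. The superscript in $\omega^n$ is an index, not a power. *)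

theory Defs
  imports "Jordan_Normal_Form.Schur_Decomposition"
begin

text \<open>\<open>M\<^sub>n\<close> is \<open>carrier_mat n n\<close>, acting on \<open>carrier_vec n\<close>. The inner product
  \<open>v \<bullet>c w = (\<Sum>i. v\<^sub>i * cnj w\<^sub>i)\<close> is linear in the first argument. The order on
  \<open>complex\<close> is the one of \<open>HOL-Library.Complex_Order\<close>, so \<open>0 \<le> z\<close> says that \<open>z\<close> is
  real and nonnegative.\<close>

definition vec_len :: "complex vec \<Rightarrow> real" where
  "vec_len v = sqrt (Re (v \<bullet>c v))"

definition op_norm :: "complex mat \<Rightarrow> real" where
  "op_norm A = Sup {vec_len (A *\<^sub>v x) | x. x \<in> carrier_vec (dim_col A) \<and> vec_len x = 1}"

definition numerical_radius :: "complex mat \<Rightarrow> real" where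
  "numerical_radius T =
     Sup {cmod ((T *\<^sub>v x) \<bullet>c x) | x. x \<in> carrier_vec (dim_col T) \<and> vec_len x = 1}"

definition positive_mat :: "nat \<Rightarrow> complex mat \<Rightarrow> bool" where
  "positive_mat n A \<longleftrightarrow> A \<in> carrier_mat n n \<and> (\<forall>x\<in>carrier_vec n. 0 \<le> (A *\<^sub>v x) \<bullet>c x)"

text \<open>\<open>|X| = (X\<^sup>* X)\<^sup>1\<^sup>/\<^sup>2\<close>, the positive square root being the unique positive
  matrix with the prescribed square.\<close>

definition mat_abs :: "complex mat \<Rightarrow> complex mat" where
  "mat_abs X = (THE P. positive_mat (dim_col X) P \<and> P * P = mat_adjoint X * X)"

definition mat_trace :: "complex mat \<Rightarrow> complex" where
  "mat_trace A = (\<Sum>i<dim_row A. A $$ (i, i))"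

text \<open>The trace of \<open>|X|\<close> is real, so taking the real part only changes the type.\<close>

definition trace_norm :: "complex mat \<Rightarrow> real" where
  "trace_norm X = Re (mat_trace (mat_abs X))"

definition unital_cstar_subalgebra :: "nat \<Rightarrow> complex mat set \<Rightarrow> bool" where
  "unital_cstar_subalgebra k A \<longleftrightarrow>
     A \<subseteq> carrier_mat k k \<and>
     1\<^sub>m k \<in> A \<and>
     (\<forall>X\<in>A. \<forall>Y\<in>A. X + Y \<in> A) \<and>
     (\<forall>c. \<forall>X\<in>A. c \<cdot>\<^sub>m X \<in> A) \<and>
     (\<forall>X\<in>A. \<forall>Y\<in>A. X * Y \<in> A) \<and>
     (\<forall>X\<in>A. mat_adjoint X \<in> A) \<and>
     (\<forall>S L. (\<forall>i::nat. S i \<in> A) \<and> L \<in> carrier_mat k k \<and>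
        (\<lambda>i. op_norm (S i - L)) \<longlonglongrightarrow> 0 \<longrightarrow> L \<in> A)"

definition cstar_generated :: "complex mat \<Rightarrow> complex mat set" where
  "cstar_generated T = \<Inter> {A. unital_cstar_subalgebra (dim_row T) A \<and> T \<in> A}"

text \<open>An \<open>m \<times> m\<close> array of \<open>k \<times> k\<close> matrices, viewed as an \<open>mk \<times> mk\<close> matrix, that is,
  as an operator on \<open>\<complex>\<^sup>m\<^sup>k\<close>, the direct sum of \<open>m\<close> copies of \<open>\<complex>\<^sup>k\<close>.\<close>

definition block_mat :: "nat \<Rightarrow> nat \<Rightarrow> (nat \<Rightarrow> nat \<Rightarrow> complex mat) \<Rightarrow> complex mat" where
  "block_mat m k B =
     mat (m * k) (m * k) (\<lambda>(r, s). B (r div k) (s div k) $$ (r mod k, s mod k))"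

text \<open>Maps from a subspace \<open>A\<close> of \<open>M\<^sub>k\<close> to \<open>M\<^sub>n\<close> are total functions of which only the
  values on \<open>A\<close> matter. An element of \<open>M\<^sub>m(A)\<close> is positive when it is so as an operator on
  \<open>\<complex>\<^sup>m\<^sup>k\<close>.\<close>

definition linear_map_on :: "nat \<Rightarrow> complex mat set \<Rightarrow> (complex mat \<Rightarrow> complex mat) \<Rightarrow> bool" where
  "linear_map_on n A \<Phi> \<longleftrightarrow>
     (\<forall>X\<in>A. \<Phi> X \<in> carrier_mat n n) \<and>
     (\<forall>X\<in>A. \<forall>Y\<in>A. \<Phi> (X + Y) = \<Phi> X + \<Phi> Y) \<and>
     (\<forall>c. \<forall>X\<in>A. \<Phi> (c \<cdot>\<^sub>m X) = c \<cdot>\<^sub>m \<Phi> X)"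

definition completely_positive ::
    "nat \<Rightarrow> nat \<Rightarrow> complex mat set \<Rightarrow> (complex mat \<Rightarrow> complex mat) \<Rightarrow> bool" where
  "completely_positive k n A \<Phi> \<longleftrightarrow>
     (\<forall>m B. (\<forall>i<m. \<forall>j<m. B i j \<in> A) \<and> positive_mat (m * k) (block_mat m k B) \<longrightarrow>
        positive_mat (m * n) (block_mat m n (\<lambda>i j. \<Phi> (B i j))))"

definition unital_cp_maps :: "nat \<Rightarrow> complex mat \<Rightarrow> (complex mat \<Rightarrow> complex mat) set" where
  "unital_cp_maps n T = {\<Phi>.
     linear_map_on n (cstar_generated T) \<Phi> \<and>
     \<Phi> (1\<^sub>m (dim_row T)) = 1\<^sub>m n \<and>
     completely_positive (dim_row T) n (cstar_generated T) \<Phi>}"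

definition matricial_range :: "nat \<Rightarrow> complex mat \<Rightarrow> complex mat set" where
  "matricial_range n T = {\<Phi> T | \<Phi>. \<Phi> \<in> unital_cp_maps n T}"

definition matricial_radius :: "nat \<Rightarrow> complex mat \<Rightarrow> real" where
  "matricial_radius n T = Sup {trace_norm X | X. X \<in> matricial_range n T}"

lemma unital_cstar_subalgebra_carrier_mat:
  "unital_cstar_subalgebra k (carrier_mat k k)"
  unfolding unital_cstar_subalgebra_def
  by (auto simp: mat_adjoint_def mat_of_rows_def)

lemma unital_cstar_subalgebra_cstar_generated:
  assumes "T \<in> carrier_mat k k"
  shows "unital_cstar_subalgebra k (cstar_generated T)" and "T \<in> cstar_generated T"
proof -
  have k: "dim_row T = k" using assms by simp
  have sub: "cstar_generated T \<subseteq> carrier_mat k k"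
    unfolding cstar_generated_def k using unital_cstar_subalgebra_carrier_mat assms by blast
  show "T \<in> cstar_generated T" by (simp add: cstar_generated_def)
  have "L \<in> A"
    if "unital_cstar_subalgebra k A" "T \<in> A" "\<forall>i::nat. S i \<in> cstar_generated T"
      "L \<in> carrier_mat k k" "(\<lambda>i. op_norm (S i - L)) \<longlonglongrightarrow> 0" for S L A
  proof -
    have "\<forall>i. S i \<in> A" using that k by (auto simp: cstar_generated_def)
    then show ?thesis using that unfolding unital_cstar_subalgebra_def by blast
  qed
  then have lim: "\<forall>S L. (\<forall>i::nat. S i \<in> cstar_generated T) \<and> L \<in> carrier_mat k k \<and>
      (\<lambda>i. op_norm (S i - L)) \<longlonglongrightarrow> 0 \<longrightarrow> L \<in> cstar_generated T"
    by (auto simp: cstar_generated_def k)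
  show "unital_cstar_subalgebra k (cstar_generated T)"
    unfolding unital_cstar_subalgebra_def
    apply (intro conjI sub lim)
    unfolding cstar_generated_def k unital_cstar_subalgebra_def
    by blast+
qed

end

(*
  A unital positive map carries the positive matrices w(T) I - Re (u T), |u| = 1, to positive
  matrices, so the numerical range of X in W^n(T) stays in the disc of radius w(T). By polar
  decomposition the trace norm of X is Tr (U X) for a unitary U; in an orthonormal eigenbasis (z_i)
  of U this trace is a sum of n terms u_i <X z_i, z_i> with |u_i| = 1, hence at most n w(T).
  Conversely, a unit vector x yields the completely positive map A |-> <A x, x> I_n, whose value
  at T has trace norm n |<T x, x>|.
*)

theory Submission
  imports Defs "Jordan_Normal_Form.Spectral_Radius"
begin

section \<open>Inner product, adjoints and orthonormal families\<close>

text \<open>The numerical radius controls <X x, y> sharply only for y = x; for two different unit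
  vectors |<X x, y>| can be twice as large. Read in an arbitrary orthonormal basis, Tr (U X) is a
  sum of terms <X z, U* z> with two different vectors, and would be bounded only with that extra
  factor 2. An eigenbasis of U makes the second vector a multiple of the first, which is why the
  constant is exactly n. This also dictates the polar factor: a partial isometry need not be normal,
  so it has to be completed to a unitary before the spectral theorem applies to it. Since
  \<open>mat_abs\<close> is a definite description, existence and uniqueness of positive square
  roots must be known before |X| can be computed; both rest on the same diagonalisation of normal
  matrices. The disc is reached through half-planes: |a| \<le> w says that Re (u a) \<le> w for all
  unimodular u, and each of these conditions comes from the positivity of a single element of the
  algebra generated by T.\<close>

lemma cscalar_prod_sum:
  fixes x y :: "complex vec"
  assumes "y \<in> carrier_vec n"
  shows "x \<bullet>c y = (\<Sum>i<n. x $ i * cnj (y $ i))"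
  using assms by (auto simp: scalar_prod_def atLeast0LessThan intro!: sum.cong)

lemma mat_adjoint_dim [simp]:
  "dim_row (mat_adjoint A) = dim_col A" "dim_col (mat_adjoint A) = dim_row A"
  by (auto simp: mat_adjoint_def)

lemma mat_adjoint_carrier [simp]:
  "mat_adjoint A \<in> carrier_mat n m \<longleftrightarrow> A \<in> carrier_mat m n"
  by (metis carrier_matD carrier_matI mat_adjoint_dim)

lemma index_mat_adjoint [simp]:
  fixes A :: "complex mat"
  assumes "i < dim_col A" "j < dim_row A"
  shows "mat_adjoint A $$ (i, j) = cnj (A $$ (j, i))"
  using assms by (simp add: mat_adjoint_def mat_of_rows_index)

lemma mat_adjoint_adjoint [simp]: "mat_adjoint (mat_adjoint A) = (A :: complex mat)"
  by (rule eq_matI) auto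

lemma index_mult_mat_sum:
  assumes "A \<in> carrier_mat m n" "B \<in> carrier_mat n l" "i < m" "j < l"
  shows "(A * B) $$ (i, j) = (\<Sum>h<n. A $$ (i, h) * B $$ (h, j))"
  using assms by (auto simp: scalar_prod_def atLeast0LessThan intro!: sum.cong)

lemma index_mult_mat_vec_sum:
  assumes "A \<in> carrier_mat m n" "v \<in> carrier_vec n" "i < m"
  shows "(A *\<^sub>v v) $ i = (\<Sum>h<n. A $$ (i, h) * v $ h)"
  using assms by (auto simp: scalar_prod_def atLeast0LessThan intro!: sum.cong)

lemma mat_adjoint_mult:
  fixes A B :: "complex mat"
  assumes "A \<in> carrier_mat m n" "B \<in> carrier_mat n l"
  shows "mat_adjoint (A * B) = mat_adjoint B * mat_adjoint A"
proof (rule eq_matI)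
  fix i j assume "i < dim_row (mat_adjoint B * mat_adjoint A)"
    "j < dim_col (mat_adjoint B * mat_adjoint A)"
  then have ij: "i < l" "j < m" using assms by auto
  have "mat_adjoint (A * B) $$ (i, j) = cnj (\<Sum>h<n. A $$ (j, h) * B $$ (h, i))"
    using assms ij index_mult_mat_sum[OF assms ij(2,1)] by (simp del: index_mult_mat(1))
  also have "\<dots> = (mat_adjoint B * mat_adjoint A) $$ (i, j)"
    using assms ij
    by (subst index_mult_mat_sum[of _ l n _ m]) (auto intro!: sum.cong simp: mult.commute)
  finally show "mat_adjoint (A * B) $$ (i, j) = (mat_adjoint B * mat_adjoint A) $$ (i, j)" .
qed (use assms in auto)

lemma cscalar_prod_adjoint:
  fixes A :: "complex mat"
  assumes "A \<in> carrier_mat m n" "x \<in> carrier_vec n" "y \<in> carrier_vec m"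
  shows "(A *\<^sub>v x) \<bullet>c y = x \<bullet>c (mat_adjoint A *\<^sub>v y)"
proof -
  have "(A *\<^sub>v x) \<bullet>c y = (\<Sum>i<m. \<Sum>j<n. A $$ (i, j) * x $ j * cnj (y $ i))"
    using assms index_mult_mat_vec_sum[OF assms(1,2)]
    by (simp add: cscalar_prod_sum[of _ m] sum_distrib_right del: index_mult_mat_vec)
  also have "\<dots> = (\<Sum>j<n. \<Sum>i<m. A $$ (i, j) * x $ j * cnj (y $ i))"
    by (rule sum.swap)
  also have "\<dots> = x \<bullet>c (mat_adjoint A *\<^sub>v y)"
    using assms
    by (auto simp: cscalar_prod_sum[of _ n] index_mult_mat_vec_sum[of "mat_adjoint A" n m y]
        sum_distrib_left mult_ac mult_mat_vec_carrier[of _ n m] simp del: index_mult_mat_vec intro!: sum.cong)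
  finally show ?thesis .
qed

lemma cscalar_prod_smult_left:
  fixes x y :: "complex vec"
  assumes "x \<in> carrier_vec n" "y \<in> carrier_vec n"
  shows "(c \<cdot>\<^sub>v x) \<bullet>c y = c * (x \<bullet>c y)"
  using assms by (auto simp: cscalar_prod_sum[of _ n] sum_distrib_left mult_ac intro!: sum.cong)

lemma cscalar_prod_smult_right:
  fixes x y :: "complex vec"
  assumes "x \<in> carrier_vec n" "y \<in> carrier_vec n"
  shows "x \<bullet>c (c \<cdot>\<^sub>v y) = cnj c * (x \<bullet>c y)"
  using assms by (auto simp: cscalar_prod_sum[of _ n] sum_distrib_left mult_ac intro!: sum.cong)

lemma cscalar_prod_add_left:
  fixes x y z :: "complex vec"
  assumes "x \<in> carrier_vec n" "y \<in> carrier_vec n" "z \<in> carrier_vec n"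
  shows "(x + y) \<bullet>c z = x \<bullet>c z + y \<bullet>c z"
  using assms by (simp add: cscalar_prod_sum[of _ n] sum.distrib ring_distribs)

lemma cscalar_prod_add_right:
  fixes x y z :: "complex vec"
  assumes "x \<in> carrier_vec n" "y \<in> carrier_vec n" "z \<in> carrier_vec n"
  shows "z \<bullet>c (x + y) = z \<bullet>c x + z \<bullet>c y"
  using assms by (simp add: cscalar_prod_sum[of _ n] sum.distrib ring_distribs)

lemma cscalar_prod_commute:
  fixes x y :: "complex vec"
  assumes "x \<in> carrier_vec n" "y \<in> carrier_vec n"
  shows "y \<bullet>c x = cnj (x \<bullet>c y)"
  using assms by (simp add: cscalar_prod_sum[of _ n] mult.commute)

lemma cscalar_prod_self:
  fixes x :: "complex vec"
  assumes "x \<in> carrier_vec n"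
  shows "x \<bullet>c x = of_real ((vec_len x)\<^sup>2)"
proof -
  have "x \<bullet>c x = of_real (\<Sum>i<n. (cmod (x $ i))\<^sup>2)"
    using assms by (simp add: cscalar_prod_sum[of _ n] flip: complex_norm_square)
  moreover have "0 \<le> (\<Sum>i<n. (cmod (x $ i))\<^sup>2)" by (simp add: sum_nonneg)
  ultimately show ?thesis by (simp add: vec_len_def)
qed

text \<open>Trades the square root in the definition of the suprema for the algebraic condition used
  in the rest of the proof.\<close>

lemma vec_len_eq_1_iff:
  assumes "x \<in> carrier_vec n"
  shows "vec_len x = 1 \<longleftrightarrow> x \<bullet>c x = 1"
proof -
  have "vec_len x \<ge> 0"
    using conjugate_square_ge_0_vec[of x] by (simp add: vec_len_def less_eq_complex_def)
  then show ?thesis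
    unfolding cscalar_prod_self[OF assms] of_real_eq_1_iff by (simp add: power2_eq_1_iff)
qed

text \<open>The scalar is returned rather than the unit vector, because orthogonality relations,
  eigenvector equations and vanishing coordinates of x then pass to the multiple.\<close>

lemma obtain_normalized:
  fixes x :: "complex vec"
  assumes "x \<in> carrier_vec n" "x \<noteq> 0\<^sub>v n"
  obtains c where "c \<noteq> 0" "(c \<cdot>\<^sub>v x) \<bullet>c (c \<cdot>\<^sub>v x) = 1"
proof
  have *: "x \<bullet>c x \<noteq> 0" using assms by simp
  then have l: "vec_len x \<noteq> 0" using cscalar_prod_self[OF assms(1)] by auto
  show "of_real (1 / vec_len x) \<noteq> (0 :: complex)" using l by simp
  have "(c \<cdot>\<^sub>v x) \<bullet>c (c \<cdot>\<^sub>v x) = c * cnj c * (x \<bullet>c x)" for c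
    using assms by (simp add: cscalar_prod_smult_left[of _ n] cscalar_prod_smult_right[of _ n])
  from this[of "of_real (1 / vec_len x)"]
  show "(of_real (1 / vec_len x) \<cdot>\<^sub>v x) \<bullet>c (of_real (1 / vec_len x) \<cdot>\<^sub>v x) = 1"
    unfolding cscalar_prod_self[OF assms(1)] using l by (simp add: power2_eq_square)
qed

section \<open>Unitary matrices and completion of orthonormal families\<close>

definition unitary_mat :: "nat \<Rightarrow> complex mat \<Rightarrow> bool" where
  "unitary_mat n U \<longleftrightarrow> U \<in> carrier_mat n n \<and> mat_adjoint U * U = 1\<^sub>m n"

text \<open>A left inverse of a square matrix is also a right inverse, so the isometry half in the
  definition yields the other half.\<close>

lemma unitary_matD:
  assumes "unitary_mat n U"
  shows "U \<in> carrier_mat n n" "mat_adjoint U * U = 1\<^sub>m n" "U * mat_adjoint U = 1\<^sub>m n"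
proof -
  show U: "U \<in> carrier_mat n n" "mat_adjoint U * U = 1\<^sub>m n" using assms by (auto simp: unitary_mat_def)
  show "U * mat_adjoint U = 1\<^sub>m n"
    using mat_mult_left_right_inverse[OF _ U(1) U(2)] U(1) by auto
qed

text \<open>The bridge between matrices and forms. With U = W the diagonal entries are values of the
  quadratic form of A at the basis vectors; with two different bases it evaluates a singular value
  decomposition.\<close>

lemma index_adjoint_mult_mult:
  fixes A U W :: "complex mat"
  assumes "A \<in> carrier_mat n n" "U \<in> carrier_mat n n" "W \<in> carrier_mat n n" "i < n" "j < n"
  shows "(mat_adjoint U * A * W) $$ (i, j) = (A *\<^sub>v col W j) \<bullet>c col U i"
proof -
  have "(mat_adjoint U * A * W) $$ (i, j) = (mat_adjoint U * (A * W)) $$ (i, j)"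
    using assms by (simp add: assoc_mult_mat[of _ n n _ n _ n])
  also have "\<dots> = (\<Sum>h<n. cnj (U $$ (h, i)) * (A * W) $$ (h, j))"
    using assms by (subst index_mult_mat_sum[of _ n n _ n]) (auto intro!: sum.cong)
  also have "\<dots> = (A *\<^sub>v col W j) \<bullet>c col U i"
    using assms by (auto simp: cscalar_prod_sum[of _ n] mult.commute intro!: sum.cong)
  finally show ?thesis .
qed

lemma index_adjoint_mult:
  fixes U W :: "complex mat"
  assumes "U \<in> carrier_mat n n" "W \<in> carrier_mat n n" "i < n" "j < n"
  shows "(mat_adjoint U * W) $$ (i, j) = col W j \<bullet>c col U i"
  using index_adjoint_mult_mult[of "1\<^sub>m n" n U W i j] assms by simp

lemma unitary_mat_iff_cols:
  assumes "U \<in> carrier_mat n n"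
  shows "unitary_mat n U \<longleftrightarrow> (\<forall>i<n. \<forall>j<n. col U i \<bullet>c col U j = (if i = j then 1 else 0))"
proof
  assume "unitary_mat n U"
  then have "col U i \<bullet>c col U j = 1\<^sub>m n $$ (j, i)" if "i < n" "j < n" for i j
    using index_adjoint_mult[OF assms assms that(2,1)] unitary_matD(2)[of n U]
    by (simp del: index_mult_mat(1))
  then show "\<forall>i<n. \<forall>j<n. col U i \<bullet>c col U j = (if i = j then 1 else 0)"
    by auto
next
  assume "\<forall>i<n. \<forall>j<n. col U i \<bullet>c col U j = (if i = j then 1 else 0)"
  then have "mat_adjoint U * U = 1\<^sub>m n"
    using assms index_adjoint_mult[OF assms assms] by (intro eq_matI) (auto simp del: index_mult_mat(1))
  then show "unitary_mat n U" using assms by (simp add: unitary_mat_def)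
qed

lemma unitary_mat_adjoint:
  assumes "unitary_mat n U"
  shows "unitary_mat n (mat_adjoint U)"
  unfolding unitary_mat_def using unitary_matD(1,3)[OF assms] by simp

lemma unitary_mat_mult:
  assumes "unitary_mat n U" "unitary_mat n W"
  shows "unitary_mat n (U * W)"
proof -
  note U = unitary_matD[OF assms(1)] and W = unitary_matD[OF assms(2)]
  have "mat_adjoint (U * W) * (U * W) = mat_adjoint W * (mat_adjoint U * U * W)"
    using U(1) W(1) by (simp add: mat_adjoint_mult[of _ n n _ n] assoc_mult_mat[of _ n n _ n _ n])
  then show ?thesis
    using U W by (simp add: unitary_mat_def)
qed

text \<open>A further orthogonal vector lies in the kernel of the square matrix whose rows are the
  conjugates of the given vectors and zero elsewhere.\<close>

lemma orthonormal_insert: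
  fixes f :: "nat \<Rightarrow> complex vec"
  assumes S: "S \<subseteq> {..<n}" "h < n" "h \<notin> S" and f: "\<forall>i\<in>S. f i \<in> carrier_vec n"
  obtains v where "v \<in> carrier_vec n" "v \<bullet>c v = 1" "\<forall>i\<in>S. v \<bullet>c f i = 0"
proof -
  define M where "M = mat n n (\<lambda>(i, j). if i \<in> S then cnj (f i $ j) else 0)"
  have M: "M \<in> carrier_mat n n" by (simp add: M_def)
  have "row M h = 0\<^sub>v n" using S by (intro eq_vecI) (auto simp: M_def)
  then have "det M = 0"
  proof -
    assume r: "row M h = 0\<^sub>v n"
    have "M = mat\<^sub>r n n (\<lambda>i. if i = h then 0\<^sub>v n else row M i)"
      using M by (intro eq_matI) (auto simp: M_def S(3))
    then show "det M = 0" using det_row_0[OF S(2), of "row M"] M by auto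
  qed
  then obtain v where v: "v \<in> carrier_vec n" "v \<noteq> 0\<^sub>v n" "M *\<^sub>v v = 0\<^sub>v n"
    using det_0_iff_vec_prod_zero[OF M] by auto
  obtain c where c: "c \<noteq> 0" "(c \<cdot>\<^sub>v v) \<bullet>c (c \<cdot>\<^sub>v v) = 1"
    using obtain_normalized[OF v(1,2)] .
  show ?thesis
  proof (rule that[of "c \<cdot>\<^sub>v v"])
    show "\<forall>i\<in>S. (c \<cdot>\<^sub>v v) \<bullet>c f i = 0"
    proof
      fix i assume i: "i \<in> S"
      then have "i < n" using S by auto
      then have "v \<bullet>c f i = (M *\<^sub>v v) $ i"
        using M v f i
        by (subst index_mult_mat_vec_sum[OF M v(1)])
           (auto simp: cscalar_prod_sum[of _ n] M_def mult.commute intro!: sum.cong)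
      then have "v \<bullet>c f i = 0" using v(3) \<open>i < n\<close> by simp
      then show "(c \<cdot>\<^sub>v v) \<bullet>c f i = 0"
        using v f i by (simp add: cscalar_prod_smult_left[of _ n])
    qed
  qed (use v c in auto)
qed

text \<open>Induction on the number of unfilled positions, one new vector at a time. The positions S
  are an arbitrary set of indices because the nonzero singular values, to which this is applied
  later, may sit anywhere on the diagonal.\<close>

lemma orthonormal_extend:
  fixes f :: "nat \<Rightarrow> complex vec"
  assumes "S \<subseteq> {..<n}" "\<forall>i\<in>S. f i \<in> carrier_vec n"
    "\<forall>i\<in>S. \<forall>j\<in>S. f i \<bullet>c f j = (if i = j then 1 else 0)"
  obtains U where "unitary_mat n U" "\<forall>i\<in>S. col U i = f i"
proof -
  have "\<exists>U. unitary_mat n U \<and> (\<forall>i\<in>S. col U i = f i)"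
    using assms
  proof (induction "card ({..<n} - S)" arbitrary: S f)
    case 0
    then have S: "S = {..<n}" by auto
    define U where "U = mat n n (\<lambda>(i, j). f j $ i)"
    have U: "U \<in> carrier_mat n n" by (simp add: U_def)
    have c: "\<forall>i\<in>S. col U i = f i"
    proof
      fix i assume "i \<in> S"
      then have "f i \<in> carrier_vec n" "i < n" using 0(3) S by auto
      then show "col U i = f i" by (intro eq_vecI) (auto simp: U_def)
    qed
    have "unitary_mat n U"
      unfolding unitary_mat_iff_cols[OF U] using c S 0(4) by simp
    with c show ?case by blast
  next
    case (Suc d)
    then obtain h where h: "h < n" "h \<notin> S"
      by (metis Diff_iff all_not_in_conv card.empty lessThan_iff nat.distinct(1))
    obtain v where v: "v \<in> carrier_vec n" "v \<bullet>c v = 1" "\<forall>i\<in>S. v \<bullet>c f i = 0"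
      using orthonormal_insert[OF Suc(3) h Suc(4)] .
    have v': "\<forall>i\<in>S. f i \<bullet>c v = 0"
    proof
      fix i assume "i \<in> S"
      then show "f i \<bullet>c v = 0"
        using v(3) Suc(4) cscalar_prod_commute[OF _ v(1), of "f i"] by simp
    qed
    have "{..<n} - insert h S = ({..<n} - S) - {h}" by auto
    then have "d = card ({..<n} - insert h S)"
      using Suc(2) h by simp
    moreover have "insert h S \<subseteq> {..<n}" using Suc(3) h by simp
    moreover have "\<forall>i\<in>insert h S. (f(h := v)) i \<in> carrier_vec n"
      using Suc(4) v(1) by auto
    moreover have "\<forall>i\<in>insert h S. \<forall>j\<in>insert h S.
        (f(h := v)) i \<bullet>c (f(h := v)) j = (if i = j then 1 else 0)"
      using Suc(5) h(2) v(2,3) v' by (auto simp del: conjugate_square_eq_0_vec)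
    ultimately obtain U where U: "unitary_mat n U" "\<forall>i\<in>insert h S. col U i = (f(h := v)) i"
      using Suc(1)[of "insert h S" "f(h := v)"] by blast
    have "\<forall>i\<in>S. col U i = f i" using U(2) h by (metis fun_upd_other insert_iff)
    with U(1) show ?case by blast
  qed
  then show thesis using that by blast
qed

lemma mult_mat_unit_vec:
  fixes A :: "'a :: comm_semiring_1 mat"
  assumes "A \<in> carrier_mat m n" "j < n"
  shows "A *\<^sub>v unit_vec n j = col A j"
  using assms by (intro eq_vecI) auto

lemma cscalar_prod_unit_vec:
  fixes x :: "complex vec"
  assumes "i < n"
  shows "x \<bullet>c unit_vec n i = x $ i"
proof -
  have "x \<bullet>c unit_vec n i = (\<Sum>h<n. if h = i then x $ h else 0)"
    unfolding cscalar_prod_sum[OF unit_vec_carrier] using assms by (intro sum.cong) auto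
  then show ?thesis using assms by simp
qed

text \<open>Stated for products bracketed to the right, the normal form under
  \<open>assoc_mult_mat\<close>, so that the conjugation identities below follow by
  rewriting.\<close>

lemma unitary_mat_cancel:
  assumes "unitary_mat n U" "X \<in> carrier_mat n l"
  shows "mat_adjoint U * (U * X) = X" "U * (mat_adjoint U * X) = X"
  using unitary_matD[OF assms(1)] assms(2)
  by (simp_all flip: assoc_mult_mat[of _ n n _ n _ l])

section \<open>Unitary diagonalisation of normal matrices\<close>

lemma unitary_conjugate_normal:
  assumes U: "unitary_mat n U" and A: "A \<in> carrier_mat n n" "A * mat_adjoint A = mat_adjoint A * A"
  defines "B \<equiv> mat_adjoint U * A * U"
  shows "B * mat_adjoint B = mat_adjoint B * B"
proof -
  note U1 = unitary_matD(1)[OF U]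
  have "mat_adjoint B = mat_adjoint U * mat_adjoint A * U"
    using U1 A(1) by (simp add: B_def mat_adjoint_mult[of _ n n _ n] assoc_mult_mat[of _ n n _ n _ n])
  moreover have "mat_adjoint U * X * U * (mat_adjoint U * Y * U) = mat_adjoint U * (X * Y) * U"
    if "X \<in> carrier_mat n n" "Y \<in> carrier_mat n n" for X Y
    using U1 that
    by (simp add: assoc_mult_mat[of _ n n _ n _ n] mult_carrier_mat[of _ n n _ n] unitary_mat_cancel[OF U, of _ n])
  ultimately show ?thesis using A by (simp add: B_def)
qed

text \<open>Comparing the (j, j) entries of B B* and B* B shows that row j and column j have the
  same length. If the column consists of its diagonal entry alone, the squares of the other entries
  of the row sum to zero.\<close>

lemma normal_row_zero:
  fixes B :: "complex mat"
  assumes B: "B \<in> carrier_mat n n" "B * mat_adjoint B = mat_adjoint B * B" and j: "j < n"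
    and z: "\<And>i. i < n \<Longrightarrow> i \<noteq> j \<Longrightarrow> B $$ (i, j) = 0"
    and i: "i < n" "i \<noteq> j"
  shows "B $$ (j, i) = 0"
proof -
  have "(B * mat_adjoint B) $$ (j, j) = of_real (\<Sum>h<n. (cmod (B $$ (j, h)))\<^sup>2)"
    using B(1) j by (subst index_mult_mat_sum[of _ n n _ n]) (auto intro!: sum.cong simp flip: complex_norm_square)
  moreover have "(mat_adjoint B * B) $$ (j, j) = of_real (\<Sum>h<n. (cmod (B $$ (h, j)))\<^sup>2)"
    using B(1) j
    by (subst index_mult_mat_sum[of _ n n _ n]) (auto intro!: sum.cong simp: mult.commute simp flip: complex_norm_square)
  ultimately have eq: "(\<Sum>h<n. (cmod (B $$ (j, h)))\<^sup>2) = (\<Sum>h<n. (cmod (B $$ (h, j)))\<^sup>2)"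
    using B(2) by (metis of_real_eq_iff)
  have "(\<Sum>h<n. (cmod (B $$ (h, j)))\<^sup>2) = (cmod (B $$ (j, j)))\<^sup>2"
    using j z by (subst sum.remove[of _ j]) auto
  moreover have "(\<Sum>h<n. (cmod (B $$ (j, h)))\<^sup>2) =
      (cmod (B $$ (j, j)))\<^sup>2 + (\<Sum>h\<in>{..<n} - {j}. (cmod (B $$ (j, h)))\<^sup>2)"
    using j by (subst sum.remove[of _ j]) auto
  ultimately have "(\<Sum>h\<in>{..<n} - {j}. (cmod (B $$ (j, h)))\<^sup>2) = 0" using eq by simp
  then show ?thesis using i by (subst (asm) sum_nonneg_eq_0_iff) auto
qed

lemma sum_lessThan_add:
  fixes f :: "nat \<Rightarrow> 'a :: comm_monoid_add"
  shows "(\<Sum>i<m + d. f i) = (\<Sum>i<m. f i) + (\<Sum>i<d. f (m + i))"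
  by (induction d) (simp_all add: add.assoc)

text \<open>Normality kills the rows next to the diagonalised columns, so the trailing block is
  a direct summand and one of its eigenvectors extends by zero.\<close>

lemma trailing_block_eigenvector:
  fixes B :: "complex mat"
  assumes B: "B \<in> carrier_mat n n" and m: "m < n"
    and z: "\<And>i j. i < m \<Longrightarrow> j < n \<Longrightarrow> i \<noteq> j \<Longrightarrow> B $$ (i, j) = 0"
  obtains u \<mu> where "u \<in> carrier_vec n" "u \<bullet>c u = 1" "\<And>i. i < m \<Longrightarrow> u $ i = 0" "B *\<^sub>v u = \<mu> \<cdot>\<^sub>v u"
proof -
  define C where "C = mat (n - m) (n - m) (\<lambda>(i, j). B $$ (m + i, m + j))"
  have C: "C \<in> carrier_mat (n - m) (n - m)" by (simp add: C_def)
  \<comment> \<open>The block has positive size because m < n, so it has a complex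
    eigenvalue.\<close>
  then obtain \<mu> w where w: "w \<in> carrier_vec (n - m)" "w \<noteq> 0\<^sub>v (n - m)" "C *\<^sub>v w = \<mu> \<cdot>\<^sub>v w"
    using spectrum_non_empty[OF C] m by (auto simp: spectrum_def eigenvalue_def eigenvector_def)
  define u where "u = vec n (\<lambda>i. if i < m then 0 else w $ (i - m))"
  have u: "u \<in> carrier_vec n" by (simp add: u_def)
  obtain i where i: "i < n - m" "w $ i \<noteq> 0"
    using w(1,2) by (metis carrier_vecD eq_vecI index_zero_vec)
  then have "u $ (m + i) \<noteq> 0" by (simp add: u_def)
  then have u0: "u \<noteq> 0\<^sub>v n" using i by auto
  have Bu: "B *\<^sub>v u = \<mu> \<cdot>\<^sub>v u"
  proof (rule eq_vecI)
    fix i assume "i < dim_vec (\<mu> \<cdot>\<^sub>v u)"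
    then have i: "i < n" using u by simp
    have "(B *\<^sub>v u) $ i = (\<Sum>h<m + (n - m). B $$ (i, h) * u $ h)"
      using m by (subst index_mult_mat_vec_sum[OF B u i]) simp
    also have "\<dots> = (\<Sum>h<n - m. B $$ (i, m + h) * w $ h)"
      unfolding sum_lessThan_add using m by (auto simp: u_def intro!: sum.cong)
    also have "\<dots> = \<mu> * u $ i"
    \<comment> \<open>For i < m, row i of B vanishes off the diagonal and u is zero there, so both
      sides are zero; for the other rows the equation is that of the block \<open>C\<close>.\<close>
    proof (cases "i < m")
      case True
      then have "(\<Sum>h<n - m. B $$ (i, m + h) * w $ h) = 0"
        using z m by (intro sum.neutral) auto
      with True i show ?thesis by (simp add: u_def)
    next
      case False
      then have "(\<Sum>h<n - m. B $$ (i, m + h) * w $ h) = (C *\<^sub>v w) $ (i - m)"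
        using i by (subst index_mult_mat_vec_sum[OF C w(1)]) (auto simp: C_def intro!: sum.cong)
      then show ?thesis using False i w(1,3) by (simp add: u_def)
    qed
    finally show "(B *\<^sub>v u) $ i = (\<mu> \<cdot>\<^sub>v u) $ i" using i u by simp
  qed (use B u in simp)
  obtain c where c: "(c \<cdot>\<^sub>v u) \<bullet>c (c \<cdot>\<^sub>v u) = 1" using obtain_normalized[OF u u0] .
  show ?thesis
  proof (rule that[of "c \<cdot>\<^sub>v u" \<mu>])
    show "B *\<^sub>v (c \<cdot>\<^sub>v u) = \<mu> \<cdot>\<^sub>v (c \<cdot>\<^sub>v u)"
      using B u Bu by (simp add: mult_mat_vec smult_smult_assoc mult.commute)
  qed (use c u m in \<open>auto simp: u_def\<close>)
qed

text \<open>The induction counts the columns already diagonal and keeps the size n fixed, so that no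
  matrices have to be assembled from smaller ones; normality survives each unitary
  conjugation.\<close>

lemma normal_unitarily_diagonalizable:
  assumes A: "A \<in> carrier_mat n n" "A * mat_adjoint A = mat_adjoint A * A"
  obtains U where "unitary_mat n U" "diagonal_mat (mat_adjoint U * A * U)"
proof -
  have "\<exists>U. unitary_mat n U \<and>
      (\<forall>j<m. \<forall>i<n. i \<noteq> j \<longrightarrow> (mat_adjoint U * A * U) $$ (i, j) = 0)" if "m \<le> n" for m
    using that
  proof (induction m)
    case 0
    have "mat_adjoint (1\<^sub>m n) = (1\<^sub>m n :: complex mat)" by (rule eq_matI) auto
    then have "unitary_mat n (1\<^sub>m n)" by (simp add: unitary_mat_def)
    then show ?case by blast
  next
    case (Suc m)
    then obtain U where U: "unitary_mat n U" and
      z: "\<And>i j. j < m \<Longrightarrow> i < n \<Longrightarrow> i \<noteq> j \<Longrightarrow> (mat_adjoint U * A * U) $$ (i, j) = 0"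
      by auto
    note U1 = unitary_matD(1)[OF U]
    define B where "B = mat_adjoint U * A * U"
    have B: "B \<in> carrier_mat n n" using U1 A by (simp add: B_def mult_carrier_mat[of _ n n _ n])
    note z = z[folded B_def]
    have nB: "B * mat_adjoint B = mat_adjoint B * B"
      unfolding B_def by (rule unitary_conjugate_normal[OF U A])
    have m: "m < n" using Suc by simp
    have z': "B $$ (i, j) = 0" if "i < m" "j < n" "i \<noteq> j" for i j
      using normal_row_zero[OF B nB, of i j] that z m by auto
    obtain u \<mu> where u: "u \<in> carrier_vec n" "u \<bullet>c u = 1" "\<And>i. i < m \<Longrightarrow> u $ i = 0"
      "B *\<^sub>v u = \<mu> \<cdot>\<^sub>v u"
      using trailing_block_eigenvector[OF B m] z' by metis
    \<comment> \<open>The first m unit vectors are already eigenvectors of \<open>B\<close>, and u,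
      supported on the remaining coordinates, is orthogonal to them. Any unitary completion of this
      family therefore diagonalises one more column.\<close>
    define f where "f = (\<lambda>i. if i < m then unit_vec n i else u)"
    define d where "d = (\<lambda>j. if j < m then B $$ (j, j) else \<mu>)"
    have ev: "B *\<^sub>v f j = d j \<cdot>\<^sub>v f j" if "j \<le> m" for j
    proof (cases "j < m")
      case True
      have "B *\<^sub>v unit_vec n j = B $$ (j, j) \<cdot>\<^sub>v unit_vec n j"
        using B m True z by (intro eq_vecI) (auto simp: mult_mat_unit_vec[OF B])
      then show ?thesis using True by (simp add: f_def d_def)
    qed (use u in \<open>simp add: f_def d_def\<close>)
    have fc: "f i \<in> carrier_vec n" for i using u by (simp add: f_def)
    have uu: "unit_vec n i \<bullet>c unit_vec n j = (if i = j then 1 else (0 :: complex))"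
      if "i < m" "j < m" for i j
      using that m by (simp add: cscalar_prod_unit_vec)
    have ui: "unit_vec n i \<bullet>c u = 0" "u \<bullet>c unit_vec n i = 0" if "i < m" for i
      using that m u cscalar_prod_commute[OF u(1), of "unit_vec n i"]
      by (simp_all add: cscalar_prod_unit_vec)
    have "\<forall>i\<in>{..m}. \<forall>j\<in>{..m}. f i \<bullet>c f j = (if i = j then 1 else 0)"
      using uu ui u(2) by (auto simp: f_def)
    moreover have "{..m} \<subseteq> {..<n}" using m by auto
    ultimately obtain W where W: "unitary_mat n W" "\<forall>i\<in>{..m}. col W i = f i"
      using orthonormal_extend[of "{..m}" n f] fc by blast
    note W1 = unitary_matD(1)[OF W(1)]
    have Wc: "col W i \<in> carrier_vec n" for i using W1 by (intro carrier_vecI) simp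
    have "(mat_adjoint W * B * W) $$ (i, j) = 0" if "j < Suc m" "i < n" "i \<noteq> j" for i j
    proof -
      have j: "j < n" "j \<le> m" using that m by auto
      have "(mat_adjoint W * B * W) $$ (i, j) = d j * (col W j \<bullet>c col W i)"
        using index_adjoint_mult_mult[OF B W1 W1 that(2) j(1)] W(2) ev[OF j(2)] j W1
          cscalar_prod_smult_left[OF fc[of j] Wc[of i], of "d j"]
        by (simp del: index_mult_mat(1))
      then show ?thesis
        using W(1) W1 that j by (simp add: unitary_mat_iff_cols del: index_mult_mat(1))
    qed
    moreover have "mat_adjoint (U * W) * A * (U * W) = mat_adjoint W * B * W"
      using U1 W1 A(1)
      by (simp add: B_def mat_adjoint_mult[of _ n n _ n] assoc_mult_mat[of _ n n _ n _ n])
    ultimately show ?case using unitary_mat_mult[OF U W(1)] by metis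
  qed
  from this[of n] obtain U where U: "unitary_mat n U"
    "\<forall>j<n. \<forall>i<n. i \<noteq> j \<longrightarrow> (mat_adjoint U * A * U) $$ (i, j) = 0" by auto
  have "diagonal_mat (mat_adjoint U * A * U)"
    using U(2) unitary_matD(1)[OF U(1)] A(1) by (simp add: diagonal_mat_def del: index_mult_mat(1))
  with U(1) show thesis by (rule that)
qed

text \<open>Column j of the identity A U = U D, where D is the diagonal conjugate of A.\<close>

lemma mult_col_diagonalized:
  assumes A: "A \<in> carrier_mat n n" and U: "unitary_mat n U"
    and d: "diagonal_mat (mat_adjoint U * A * U)" and j: "j < n"
  shows "A *\<^sub>v col U j = (mat_adjoint U * A * U) $$ (j, j) \<cdot>\<^sub>v col U j"
proof -
  note U1 = unitary_matD(1)[OF U]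
  define D where "D = mat_adjoint U * A * U"
  have D: "D \<in> carrier_mat n n" using U1 A by (simp add: D_def mult_carrier_mat[of _ n n _ n])
  have "A * U = U * D"
    using U1 A by (simp add: D_def unitary_mat_cancel[OF U, of _ n] mult_carrier_mat[of _ n n _ n] assoc_mult_mat[of _ n n _ n _ n])
  then have "A *\<^sub>v col U j = col (U * D) j" using A U1 j by (metis col_mult2)
  also have "\<dots> = D $$ (j, j) \<cdot>\<^sub>v col U j"
  proof (rule eq_vecI)
    fix i assume "i < dim_vec (D $$ (j, j) \<cdot>\<^sub>v col U j)"
    then have i: "i < n" using U1 by simp
    have "col (U * D) j $ i = (U * D) $$ (i, j)"
      using U1 D i j by (simp del: col_mult2)
    also have "\<dots> = (\<Sum>h<n. U $$ (i, h) * D $$ (h, j))"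
      by (rule index_mult_mat_sum[OF U1 D i j])
    also have "\<dots> = (\<Sum>h<n. if h = j then U $$ (i, h) * D $$ (h, j) else 0)"
      using d D j by (intro sum.cong) (auto simp: diagonal_mat_def simp flip: D_def)
    also have "\<dots> = U $$ (i, j) * D $$ (j, j)" using j by simp
    finally show "col (U * D) j $ i = (D $$ (j, j) \<cdot>\<^sub>v col U j) $ i"
      using U1 i j by (simp add: mult.commute)
  qed (use U1 D in simp)
  finally show ?thesis by (simp add: D_def)
qed

section \<open>Positive square roots\<close>

lemma positive_matD:
  assumes "positive_mat n A"
  shows "A \<in> carrier_mat n n" "x \<in> carrier_vec n \<Longrightarrow> 0 \<le> (A *\<^sub>v x) \<bullet>c x"
  using assms by (auto simp: positive_mat_def)

lemma cscalar_prod_mult_unit_vec: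
  fixes A :: "complex mat"
  assumes "A \<in> carrier_mat n n" "i < n" "j < n"
  shows "(A *\<^sub>v unit_vec n j) \<bullet>c unit_vec n i = A $$ (i, j)"
  using assms by (simp add: mult_mat_unit_vec[OF assms(1,3)] cscalar_prod_unit_vec del: index_mult_mat_vec)

text \<open>Polarisation over the vectors \<open>e\<^sub>j + c e\<^sub>i\<close> with \<open>c \<in> {1, \<i>}\<close>.\<close>

lemma positive_mat_hermitian:
  assumes "positive_mat n A"
  shows "mat_adjoint A = A"
proof (rule eq_matI)
  note A = positive_matD[OF assms]
  define q where "q = (\<lambda>x y. (A *\<^sub>v x) \<bullet>c y)"
  have real: "Im (q x x) = 0" if "x \<in> carrier_vec n" for x
    using A(2)[OF that] by (simp add: q_def less_eq_complex_def)
  have expand: "q (x + c \<cdot>\<^sub>v y) (x + c \<cdot>\<^sub>v y) = q x x + c * q y x + cnj c * q x y + c * cnj c * q y y"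
    if "x \<in> carrier_vec n" "y \<in> carrier_vec n" for x y c
    using that A(1)
    by (simp add: q_def mult_add_distrib_mat_vec[of _ n n] mult_mat_vec[of _ n n] cscalar_prod_add_left[of _ n]
        cscalar_prod_add_right[of _ n] cscalar_prod_smult_left[of _ n] cscalar_prod_smult_right[of _ n]
        mult_mat_vec_carrier[of _ n n] algebra_simps)
  fix i j assume "i < dim_row A" "j < dim_col A"
  then have ij: "i < n" "j < n" using A(1) by auto
  have entry: "q (unit_vec n j) (unit_vec n i) = A $$ (i, j)" if "i < n" "j < n" for i j
    unfolding q_def using cscalar_prod_mult_unit_vec[OF A(1)] that by simp
  note e = expand[of "unit_vec n j" "unit_vec n i"]
  \<comment> \<open>Reality of the form at c = 1 makes the imaginary parts of the two entries
    opposite; at c = \<i> it makes their real parts equal.\<close>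
  have "Im (A $$ (j, i)) + Im (A $$ (i, j)) = 0"
    using real[of "unit_vec n j + 1 \<cdot>\<^sub>v unit_vec n i"] real[of "unit_vec n j"] real[of "unit_vec n i"]
      e[of 1] entry ij by simp
  moreover have "Re (A $$ (j, i)) - Re (A $$ (i, j)) = 0"
    using real[of "unit_vec n j + \<i> \<cdot>\<^sub>v unit_vec n i"] real[of "unit_vec n j"] real[of "unit_vec n i"]
      e[of \<i>] entry ij by simp
  ultimately show "mat_adjoint A $$ (i, j) = A $$ (i, j)"
    using ij A(1) by (simp add: complex_eq_iff)
qed (use positive_matD[OF assms] in auto)

lemma positive_mat_unitary_conjugate:
  assumes "unitary_mat n U" "positive_mat n A"
  shows "positive_mat n (mat_adjoint U * A * U)"
proof -
  note U = unitary_matD(1)[OF assms(1)] and A = positive_matD[OF assms(2)]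
  have "(mat_adjoint U * A * U *\<^sub>v x) \<bullet>c x = (A *\<^sub>v (U *\<^sub>v x)) \<bullet>c (U *\<^sub>v x)"
    if "x \<in> carrier_vec n" for x
    using U A(1) that
    by (simp add: assoc_mult_mat[of _ n n _ n _ n] assoc_mult_mat_vec[of _ n n _ n]
        cscalar_prod_adjoint[of "mat_adjoint U" n n] mult_mat_vec_carrier[of _ n n])
  then show ?thesis
    using U A by (simp add: positive_mat_def mult_carrier_mat[of _ n n _ n] mult_mat_vec_carrier[of _ n n])
qed

lemma positive_mat_diagonalize:
  assumes "positive_mat n A"
  obtains U where "unitary_mat n U" "diagonal_mat (mat_adjoint U * A * U)"
    "positive_mat n (mat_adjoint U * A * U)"
  using normal_unitarily_diagonalizable[of A n] positive_matD(1)[OF assms] positive_mat_hermitian[OF assms]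
    positive_mat_unitary_conjugate[OF _ assms] by metis

lemma positive_mat_index_nonneg:
  assumes "positive_mat n A" "i < n"
  shows "0 \<le> A $$ (i, i)"
  using positive_matD(2)[OF assms(1), of "unit_vec n i"]
    cscalar_prod_mult_unit_vec[OF positive_matD(1)[OF assms(1)] assms(2,2)] by simp

text \<open>Roots are taken entrywise in an orthonormal eigenbasis and conjugated back.\<close>

lemma positive_mat_sqrt_exists:
  assumes "positive_mat n A"
  obtains P where "positive_mat n P" "P * P = A"
proof -
  obtain U where U: "unitary_mat n U" "diagonal_mat (mat_adjoint U * A * U)"
    "positive_mat n (mat_adjoint U * A * U)"
    using positive_mat_diagonalize[OF assms] .
  note U1 = unitary_matD(1)[OF U(1)]
  define D where "D = mat_adjoint U * A * U"
  have D: "D \<in> carrier_mat n n" using U(3) by (simp add: positive_mat_def D_def)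
  have Dii: "D $$ (i, i) = of_real (Re (D $$ (i, i)))" "0 \<le> Re (D $$ (i, i))" if "i < n" for i
    using positive_mat_index_nonneg[OF U(3)[folded D_def] that]
    by (auto simp: less_eq_complex_def complex_eq_iff)
  \<comment> \<open>The diagonal of a positive matrix is real and nonnegative, so \<open>Re\<close>
    loses nothing and the real square root squares back to the entry.\<close>
  define E where "E = mat n n (\<lambda>(i, j). if i = j then complex_of_real (sqrt (Re (D $$ (i, i)))) else 0)"
  have E: "E \<in> carrier_mat n n" by (simp add: E_def)
  have EE: "E * E = D"
  proof (rule eq_matI)
    fix i j assume "i < dim_row D" "j < dim_col D"
    then have ij: "i < n" "j < n" using D by auto
    have "(E * E) $$ (i, j) = (\<Sum>h<n. if h = i then E $$ (i, h) * E $$ (h, j) else 0)"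
      unfolding index_mult_mat_sum[OF E E ij] using ij by (intro sum.cong) (auto simp: E_def)
    also have "\<dots> = E $$ (i, i) * E $$ (i, j)" using ij by simp
    also have "\<dots> = D $$ (i, j)"
    proof (cases "i = j")
      case True
      then show ?thesis
        using Dii[OF ij(1)] ij by (simp add: E_def flip: of_real_mult)
    next
      case False
      then show ?thesis using U(2) D ij by (simp add: E_def diagonal_mat_def flip: D_def)
    qed
    finally show "(E * E) $$ (i, j) = D $$ (i, j)" .
  qed (use D E in auto)
  have "positive_mat n E"
    unfolding positive_mat_def
  proof (intro conjI ballI E)
    fix x :: "complex vec" assume x: "x \<in> carrier_vec n"
    have "(E *\<^sub>v x) $ i = of_real (sqrt (Re (D $$ (i, i)))) * x $ i" if "i < n" for i
      unfolding index_mult_mat_vec_sum[OF E x that] using that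
      by (simp add: E_def if_distrib if_distribR cong: if_cong)
    then have "(E *\<^sub>v x) \<bullet>c x = (\<Sum>i<n. of_real (sqrt (Re (D $$ (i, i))) * (cmod (x $ i))\<^sup>2))"
      using x by (simp add: cscalar_prod_sum[of _ n] mult.assoc del: index_mult_mat_vec flip: complex_norm_square)
    also have "\<dots> \<ge> 0"
      using Dii(2) by (intro sum_nonneg) (simp add: less_eq_complex_def)
    finally show "0 \<le> (E *\<^sub>v x) \<bullet>c x" .
  qed
  then have "positive_mat n (U * E * mat_adjoint U)"
    using positive_mat_unitary_conjugate[OF unitary_mat_adjoint[OF U(1)]] by simp
  moreover have "U * E * mat_adjoint U * (U * E * mat_adjoint U) = U * (E * E) * mat_adjoint U"
    using U1 E
    by (simp add: assoc_mult_mat[of _ n n _ n _ n] mult_carrier_mat[of _ n n _ n] unitary_mat_cancel[OF U(1), of _ n])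
  moreover have "\<dots> = A"
    using U1 positive_matD(1)[OF assms] unitary_matD(3)[OF U(1)] unfolding EE D_def
    by (simp add: assoc_mult_mat[of _ n n _ n _ n] mult_carrier_mat[of _ n n _ n] unitary_mat_cancel[OF U(1), of _ n])
  ultimately show thesis using that by metis
qed

text \<open>If \<open>(P - Q) v = \<mu> v\<close>, then \<open>\<parallel>P v\<parallel> = \<parallel>Q v\<parallel>\<close> gives \<open>\<mu> (\<langle>P v, v\<rangle> + \<langle>Q v, v\<rangle>) = 0\<close>, so that
  every eigenvalue of \<open>P - Q\<close> vanishes.\<close>

lemma positive_mat_sqrt_unique:
  assumes "positive_mat n P" "positive_mat n Q" "P * P = Q * Q"
  shows "P = Q"
proof -
  note P = positive_matD[OF assms(1)] and Q = positive_matD[OF assms(2)]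
  note hP = positive_mat_hermitian[OF assms(1)] and hQ = positive_mat_hermitian[OF assms(2)]
  define H where "H = P - Q"
  have H: "H \<in> carrier_mat n n" using P(1) Q(1) by (auto simp: H_def)
  have "mat_adjoint H = mat_adjoint P - mat_adjoint Q"
    using P(1) Q(1) by (intro eq_matI) (auto simp: H_def)
  then have hH: "mat_adjoint H = H" by (simp add: hP hQ H_def)
  obtain U where U: "unitary_mat n U" "diagonal_mat (mat_adjoint U * H * U)"
    using normal_unitarily_diagonalizable[OF H] hH by metis
  note U1 = unitary_matD(1)[OF U(1)]
  define D where "D = mat_adjoint U * H * U"
  have D: "D \<in> carrier_mat n n" using U1 H by (simp add: D_def mult_carrier_mat[of _ n n _ n])
  have "D $$ (j, j) = 0" if j: "j < n" for j
  proof -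
    define v where "v = col U j"
    define \<mu> where "\<mu> = D $$ (j, j)"
    have v: "v \<in> carrier_vec n" using U1 j by (simp add: v_def)
    have vv: "v \<bullet>c v = 1" using U(1) U1 j by (simp add: unitary_mat_iff_cols v_def)
    have "H *\<^sub>v v = \<mu> \<cdot>\<^sub>v v"
      using mult_col_diagonalized[OF H U j] by (simp add: v_def \<mu>_def D_def)
    moreover have "P = Q + H" using P(1) Q(1) by (intro eq_matI) (auto simp: H_def)
    then have "P *\<^sub>v v = Q *\<^sub>v v + H *\<^sub>v v"
      using add_mult_distrib_mat_vec[OF Q(1) H v] by simp
    ultimately have Pv: "P *\<^sub>v v = Q *\<^sub>v v + \<mu> \<cdot>\<^sub>v v" by simp
    have Pc: "P *\<^sub>v v \<in> carrier_vec n" and Qc: "Q *\<^sub>v v \<in> carrier_vec n"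
      using P(1) Q(1) v by auto
    define p where "p = (P *\<^sub>v v) \<bullet>c v"
    define q where "q = (Q *\<^sub>v v) \<bullet>c v"
    have p0: "0 \<le> p" and q0: "0 \<le> q" using P(2) Q(2) v by (auto simp: p_def q_def)
    have pq: "p = q + \<mu>"
      unfolding p_def Pv using Qc v vv
      by (simp add: cscalar_prod_add_left[of _ n] cscalar_prod_smult_left[of _ n] q_def)
    have "(P *\<^sub>v v) \<bullet>c (P *\<^sub>v v) = (P * P *\<^sub>v v) \<bullet>c v"
      using P(1) v Pc hP cscalar_prod_adjoint[OF P(1) Pc v] by (simp add: assoc_mult_mat_vec[of _ n n _ n])
    moreover have "(Q *\<^sub>v v) \<bullet>c (Q *\<^sub>v v) = (Q * Q *\<^sub>v v) \<bullet>c v"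
      using Q(1) v Qc hQ cscalar_prod_adjoint[OF Q(1) Qc v] by (simp add: assoc_mult_mat_vec[of _ n n _ n])
    ultimately have "(Q *\<^sub>v v + \<mu> \<cdot>\<^sub>v v) \<bullet>c (Q *\<^sub>v v + \<mu> \<cdot>\<^sub>v v) = (Q *\<^sub>v v) \<bullet>c (Q *\<^sub>v v)"
      using assms(3) Pv by simp
    then have "cnj \<mu> * q + \<mu> * cnj q + \<mu> * cnj \<mu> = 0"
      using Qc v vv cscalar_prod_commute[OF Qc v]
      by (simp add: cscalar_prod_add_left[of _ n] cscalar_prod_smult_left[of _ n]
          cscalar_prod_add_right[of _ n] cscalar_prod_smult_right[of _ n] q_def algebra_simps)
    moreover have \<mu>: "\<mu> = of_real (Re p - Re q)" and q: "q = of_real (Re q)"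
      using p0 q0 pq by (auto simp: less_eq_complex_def complex_eq_iff)
    \<comment> \<open>With everything real and \<mu> = p - q, the expression 2 \<mu> q + \<mu>^2
      factors as (p - q)(p + q).\<close>
    have "cnj \<mu> * q + \<mu> * cnj q + \<mu> * cnj \<mu> = of_real ((Re p - Re q) * (Re p + Re q))"
      by (subst (1 2) q, subst (1 2 3 4) \<mu>) (simp add: algebra_simps)
    ultimately have "of_real ((Re p - Re q) * (Re p + Re q)) = (0 :: complex)" by metis
    then have "(Re p - Re q) * (Re p + Re q) = 0" using of_real_eq_0_iff by blast
    \<comment> \<open>If the factor p + q is the one that vanishes, nonnegativity forces p = q = 0,
      so the two agree in either case.\<close>
    then have "Re p = Re q" using p0 q0 by (auto simp: less_eq_complex_def)
    with \<mu> show ?thesis by (simp add: \<mu>_def)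
  qed
  then have "D $$ (i, j) = 0" if "i < n" "j < n" for i j
    using U(2) D that unfolding D_def[symmetric] diagonal_mat_def by (cases "i = j") auto
  then have "D = 0\<^sub>m n n"
    using D by (intro eq_matI) auto
  moreover have "H = U * D * mat_adjoint U"
    using U1 H unitary_matD(3)[OF U(1)] unfolding D_def
    by (simp add: assoc_mult_mat[of _ n n _ n _ n] mult_carrier_mat[of _ n n _ n] unitary_mat_cancel[OF U(1), of _ n])
  ultimately have "H = 0\<^sub>m n n" using U1 by simp
  then have "(P - Q) $$ (i, j) = 0" if "i < n" "j < n" for i j
    using that by (simp add: H_def)
  then show ?thesis
    using P(1) Q(1) by (intro eq_matI) auto
qed

lemma positive_mat_adjoint_mult:
  assumes "X \<in> carrier_mat m n"
  shows "positive_mat n (mat_adjoint X * X)"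
proof -
  have "(mat_adjoint X * X *\<^sub>v x) \<bullet>c x = (X *\<^sub>v x) \<bullet>c (X *\<^sub>v x)" if "x \<in> carrier_vec n" for x
    using assms that
    by (simp add: assoc_mult_mat_vec[of _ n m _ n] cscalar_prod_adjoint[of "mat_adjoint X" n m])
  then show ?thesis using assms by (auto simp: positive_mat_def)
qed

text \<open>Uniqueness of the positive root turns the definite description in \<open>mat_abs\<close>
  into two properties to check.\<close>

lemma mat_abs_eqI:
  assumes "X \<in> carrier_mat n n" "positive_mat n P" "P * P = mat_adjoint X * X"
  shows "mat_abs X = P"
  unfolding mat_abs_def using assms positive_mat_sqrt_unique by (intro the_equality) auto

lemma mat_abs:
  assumes "X \<in> carrier_mat n n"
  shows "positive_mat n (mat_abs X)" "mat_abs X * mat_abs X = mat_adjoint X * X"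
proof -
  obtain P where "positive_mat n P" "P * P = mat_adjoint X * X"
    using positive_mat_sqrt_exists[OF positive_mat_adjoint_mult[OF assms]] .
  with mat_abs_eqI[OF assms] show "positive_mat n (mat_abs X)" "mat_abs X * mat_abs X = mat_adjoint X * X"
    by auto
qed

section \<open>Trace norm\<close>

lemma mat_trace_mult_commute:
  assumes "A \<in> carrier_mat n m" "B \<in> carrier_mat m n"
  shows "mat_trace (A * B) = mat_trace (B * A)"
proof -
  have "mat_trace (A * B) = (\<Sum>i<n. \<Sum>h<m. A $$ (i, h) * B $$ (h, i))"
    using assms by (simp add: mat_trace_def index_mult_mat_sum[OF assms] del: index_mult_mat(1))
  also have "\<dots> = (\<Sum>h<m. \<Sum>i<n. B $$ (h, i) * A $$ (i, h))"
    by (subst sum.swap) (simp add: mult.commute)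
  also have "\<dots> = mat_trace (B * A)"
    using assms by (simp add: mat_trace_def index_mult_mat_sum[OF assms(2,1)] del: index_mult_mat(1))
  finally show ?thesis .
qed

text \<open>Makes the polar factor eligible for diagonalisation.\<close>

lemma unitary_mat_normal:
  "unitary_mat n U \<Longrightarrow> U * mat_adjoint U = mat_adjoint U * U"
  using unitary_matD(2,3) by metis

text \<open>A singular value decomposition of \<open>X\<close>: where the singular value is positive, the left
  singular vector is forced; the others come from extending the orthonormal family.\<close>

lemma polar_trace:
  assumes X: "X \<in> carrier_mat n n"
  obtains U where "unitary_mat n U" "mat_trace (mat_abs X) = mat_trace (U * X)"
proof -
  define P where "P = mat_abs X"
  note pP = mat_abs(1)[OF X, folded P_def] and PP = mat_abs(2)[OF X, folded P_def]
  note P = positive_matD(1)[OF pP]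
  obtain V where V: "unitary_mat n V" "diagonal_mat (mat_adjoint V * P * V)"
    using positive_mat_diagonalize[OF pP] .
  note V1 = unitary_matD(1)[OF V(1)]
  define D where "D = mat_adjoint V * P * V"
  have D: "D \<in> carrier_mat n n" using V1 P by (simp add: D_def mult_carrier_mat[of _ n n _ n])
  define v where "v = col V"
  define s where "s = (\<lambda>i. D $$ (i, i))"
  have v: "v i \<in> carrier_vec n" for i unfolding v_def using V1 by (intro carrier_vecI) simp
  have vv: "v i \<bullet>c v j = (if i = j then 1 else 0)" if "i < n" "j < n" for i j
    using V(1) V1 that by (simp add: unitary_mat_iff_cols v_def)
  have Pv: "P *\<^sub>v v i = s i \<cdot>\<^sub>v v i" if "i < n" for i
    using mult_col_diagonalized[OF P V that] by (simp add: v_def s_def D_def)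
  have Xv: "X *\<^sub>v v i \<in> carrier_vec n" for i using X v by simp
  \<comment> \<open>Since X* X = P P with P Hermitian, the vectors X v_i have the same inner
    products as the vectors P v_i = s_i v_i.\<close>
  have XX: "(X *\<^sub>v v i) \<bullet>c (X *\<^sub>v v j) = s i * cnj (s j) * (if i = j then 1 else 0)"
    if "i < n" "j < n" for i j
  proof -
    have "(X *\<^sub>v v i) \<bullet>c (X *\<^sub>v v j) = (mat_adjoint X * X *\<^sub>v v i) \<bullet>c v j"
      using cscalar_prod_adjoint[of "mat_adjoint X" n n "X *\<^sub>v v i" "v j"] X v Xv
      by (simp add: assoc_mult_mat_vec[of _ n n _ n])
    also have "\<dots> = (P *\<^sub>v v i) \<bullet>c (P *\<^sub>v v j)"
      using cscalar_prod_adjoint[of P n n "P *\<^sub>v v i" "v j"] P v positive_mat_hermitian[OF pP]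
      by (simp add: assoc_mult_mat_vec[of _ n n _ n] flip: PP)
    also have "\<dots> = s i * cnj (s j) * (if i = j then 1 else 0)"
      using v vv that
      by (simp add: Pv cscalar_prod_smult_left[of _ n] cscalar_prod_smult_right[of _ n])
    finally show ?thesis .
  qed
  \<comment> \<open>The left singular vectors. Where s_i = 0 the convention 1 / 0 = 0 gives the zero
    vector, and these indices are left to the completion.\<close>
  define f where "f = (\<lambda>i. (1 / s i) \<cdot>\<^sub>v (X *\<^sub>v v i))"
  have "\<forall>i\<in>{i. i < n \<and> s i \<noteq> 0}. \<forall>j\<in>{i. i < n \<and> s i \<noteq> 0}. f i \<bullet>c f j = (if i = j then 1 else 0)"
    using Xv XX by (auto simp: f_def cscalar_prod_smult_left[of _ n] cscalar_prod_smult_right[of _ n])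
  then obtain W where W: "unitary_mat n W" "\<forall>i\<in>{i. i < n \<and> s i \<noteq> 0}. col W i = f i"
    using orthonormal_extend[of "{i. i < n \<and> s i \<noteq> 0}" n f] Xv f_def by auto
  note W1 = unitary_matD(1)[OF W(1)]
  \<comment> \<open>At s_i = 0 the vector X v_i has length zero, so the equation holds whatever
    column the completion has put there.\<close>
  have XvW: "X *\<^sub>v v i = s i \<cdot>\<^sub>v col W i" if i: "i < n" for i
  proof (cases "s i = 0")
    case True
    then have "(X *\<^sub>v v i) \<bullet>c (X *\<^sub>v v i) = 0" using XX[OF i i] by simp
    then have "X *\<^sub>v v i = 0\<^sub>v n" using Xv conjugate_square_eq_0_vec by blast
    then show ?thesis using True W1 by (auto intro!: eq_vecI)
  next
    case False
    then have "col W i = f i" using W(2) i by simp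
    then show ?thesis using False Xv by (simp add: f_def smult_smult_assoc)
  qed
  \<comment> \<open>As X sends v_i to s_i w_i, the unitary wanted is V W*, which sends w_i back to
    v_i. By cyclicity its trace against X is that of W* X V, whose diagonal is s, and Tr P is the
    same sum.\<close>
  have "mat_trace (V * mat_adjoint W * X) = mat_trace (V * (mat_adjoint W * X))"
    using V1 W1 X by (simp add: assoc_mult_mat[of _ n n _ n _ n])
  also have "\<dots> = mat_trace (mat_adjoint W * X * V)"
    using V1 W1 X by (intro mat_trace_mult_commute[of _ n n]) (auto simp: mult_carrier_mat[of _ n n _ n])
  also have "\<dots> = (\<Sum>i<n. s i)"
  proof -
    have "(mat_adjoint W * X * V) $$ (i, i) = s i" if "i < n" for i
      using W(1) W1 that XvW[OF that] index_adjoint_mult_mult[OF X W1 V1 that that]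
      by (simp add: v_def cscalar_prod_smult_left[of _ n] unitary_mat_iff_cols del: index_mult_mat(1))
    then show ?thesis using W1 by (simp add: mat_trace_def del: index_mult_mat(1))
  qed
  also have "\<dots> = mat_trace D" using D by (simp add: mat_trace_def s_def)
  also have "\<dots> = mat_trace (V * (mat_adjoint V * P))"
    unfolding D_def using V1 P by (intro mat_trace_mult_commute[of _ n n]) (auto simp: mult_carrier_mat[of _ n n _ n])
  also have "\<dots> = mat_trace P" using unitary_mat_cancel(2)[OF V(1) P] by simp
  finally show thesis
    using that[of "V * mat_adjoint W"] unitary_mat_mult[OF V(1) unitary_mat_adjoint[OF W(1)]] P_def by simp
qed

text \<open>In an eigenbasis Z of U, with D and Y the conjugates of U and X, the trace of U X
  becomes that of Y D. As D is diagonal, only diagonal entries of Y enter, and these are values of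
  the quadratic form at unit vectors.\<close>

lemma trace_norm_le:
  assumes X: "X \<in> carrier_mat n n"
    and r: "\<And>x. x \<in> carrier_vec n \<Longrightarrow> x \<bullet>c x = 1 \<Longrightarrow> cmod ((X *\<^sub>v x) \<bullet>c x) \<le> r"
  shows "trace_norm X \<le> real n * r"
proof -
  obtain U where U: "unitary_mat n U" "mat_trace (mat_abs X) = mat_trace (U * X)"
    using polar_trace[OF X] .
  note U1 = unitary_matD(1)[OF U(1)]
  obtain Z where Z: "unitary_mat n Z" "diagonal_mat (mat_adjoint Z * U * Z)"
    using normal_unitarily_diagonalizable[OF U1 unitary_mat_normal[OF U(1)]] .
  note Z1 = unitary_matD(1)[OF Z(1)]
  define D where "D = mat_adjoint Z * U * Z"
  define Y where "Y = mat_adjoint Z * X * Z"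
  have D: "D \<in> carrier_mat n n" and Y: "Y \<in> carrier_mat n n"
    using Z1 U1 X by (simp_all add: D_def Y_def mult_carrier_mat[of _ n n _ n])
  have uD: "unitary_mat n D"
    unfolding D_def by (intro unitary_mat_mult unitary_mat_adjoint U Z)
  \<comment> \<open>D is both unitary and diagonal, so the (i, i) entry of D* D = I is the single
    term |d_ii|^2.\<close>
  have D1: "cmod (D $$ (i, i)) = 1" if "i < n" for i
  proof -
    have z: "D $$ (h, i) = 0" if "h < n" "h \<noteq> i" for h
      using D that \<open>i < n\<close> Z(2) unfolding D_def[symmetric] by (simp add: diagonal_mat_def)
    have "1 = (mat_adjoint D * D) $$ (i, i)" using unitary_matD(2)[OF uD] that by simp
    also have "\<dots> = (\<Sum>h<n. if h = i then cnj (D $$ (h, i)) * D $$ (h, i) else 0)"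
      using D that z by (subst index_mult_mat_sum[of _ n n _ n]) (auto intro!: sum.cong simp del: sum.delta sum.delta')
    also have "\<dots> = of_real ((cmod (D $$ (i, i)))\<^sup>2)"
      using that unfolding complex_norm_square by (simp add: mult.commute)
    finally show ?thesis by (metis norm_ge_zero of_real_eq_1_iff power2_eq_1_iff abs_of_nonneg abs_1 abs_minus)
  qed
  have "mat_trace (U * X) = mat_trace (U * Z * (mat_adjoint Z * X))"
    using U1 Z1 X
    by (simp add: assoc_mult_mat[of _ n n _ n _ n] mult_carrier_mat[of _ n n _ n] unitary_mat_cancel[OF Z(1), of _ n])
  also have "\<dots> = mat_trace (mat_adjoint Z * X * (U * Z))"
    using U1 Z1 X by (intro mat_trace_mult_commute[of _ n n]) (auto simp: mult_carrier_mat[of _ n n _ n])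
  also have "mat_adjoint Z * X * (U * Z) = Y * D"
    using U1 Z1 X unfolding Y_def D_def
    by (simp add: assoc_mult_mat[of _ n n _ n _ n] mult_carrier_mat[of _ n n _ n] unitary_mat_cancel[OF Z(1), of _ n])
  also have "mat_trace (Y * D) = (\<Sum>i<n. Y $$ (i, i) * D $$ (i, i))"
  proof -
    have "(Y * D) $$ (i, i) = Y $$ (i, i) * D $$ (i, i)" if "i < n" for i
    proof -
      have "(Y * D) $$ (i, i) = (\<Sum>h<n. if h = i then Y $$ (i, h) * D $$ (h, i) else 0)"
        unfolding index_mult_mat_sum[OF Y D that that]
        using D that Z(2) unfolding D_def[symmetric] by (intro sum.cong) (auto simp: diagonal_mat_def)
      then show ?thesis using that by simp
    qed
    then show ?thesis using Y by (simp add: mat_trace_def del: index_mult_mat(1))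
  qed
  finally have "trace_norm X = Re (\<Sum>i<n. Y $$ (i, i) * D $$ (i, i))"
    using U(2) by (simp add: trace_norm_def)
  also have "\<dots> \<le> cmod (\<Sum>i<n. Y $$ (i, i) * D $$ (i, i))" by (rule complex_Re_le_cmod)
  also have "\<dots> \<le> (\<Sum>i<n. cmod (Y $$ (i, i) * D $$ (i, i)))" by (rule norm_sum)
  also have "\<dots> \<le> (\<Sum>i<n. r)"
  proof (rule sum_mono)
    fix i assume "i \<in> {..<n}"
    then have i: "i < n" by simp
    have "Y $$ (i, i) = (X *\<^sub>v col Z i) \<bullet>c col Z i"
      unfolding Y_def by (rule index_adjoint_mult_mult[OF X Z1 Z1 i i])
    moreover have "col Z i \<bullet>c col Z i = 1" "col Z i \<in> carrier_vec n"
      using Z(1) Z1 i by (simp_all add: unitary_mat_iff_cols)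
    ultimately show "cmod (Y $$ (i, i) * D $$ (i, i)) \<le> r"
      using r D1[OF i] by (simp add: norm_mult)
  qed
  finally show ?thesis by simp
qed

lemma smult_mat_mult_vec:
  fixes M :: "complex mat"
  assumes "M \<in> carrier_mat m n" "x \<in> carrier_vec n"
  shows "(a \<cdot>\<^sub>m M) *\<^sub>v x = a \<cdot>\<^sub>v (M *\<^sub>v x)"
  using assms by (intro eq_vecI) auto

text \<open>|c| I is positive with square |c|^2 I, hence is the absolute value of c I. These scalar
  matrices are where the factor n is attained.\<close>

lemma trace_norm_smult_one: "trace_norm (c \<cdot>\<^sub>m 1\<^sub>m n) = real n * cmod c"
proof -
  have "mat_abs (c \<cdot>\<^sub>m 1\<^sub>m n) = of_real (cmod c) \<cdot>\<^sub>m 1\<^sub>m n"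
  proof (rule mat_abs_eqI)
    have "(complex_of_real (cmod c) \<cdot>\<^sub>m 1\<^sub>m n *\<^sub>v x) \<bullet>c x = of_real (cmod c) * (x \<bullet>c x)"
      if "x \<in> carrier_vec n" for x
      using that by (simp add: smult_mat_mult_vec[of _ n n] cscalar_prod_smult_left[of _ n])
    then show "positive_mat n (of_real (cmod c) \<cdot>\<^sub>m 1\<^sub>m n)"
      by (auto simp: positive_mat_def less_eq_complex_def cscalar_prod_self)
    have "mat_adjoint (c \<cdot>\<^sub>m 1\<^sub>m n) = cnj c \<cdot>\<^sub>m 1\<^sub>m n" by (rule eq_matI) auto
    moreover have "(a \<cdot>\<^sub>m 1\<^sub>m n) * (b \<cdot>\<^sub>m 1\<^sub>m n) = (a * b) \<cdot>\<^sub>m 1\<^sub>m n" for a b :: complex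
      unfolding mult_smult_assoc_mat[OF one_carrier_mat smult_carrier_mat[OF one_carrier_mat]]
        mult_smult_distrib[OF one_carrier_mat one_carrier_mat] right_mult_one_mat[OF one_carrier_mat]
      by (rule eq_matI) simp_all
    ultimately show "of_real (cmod c) \<cdot>\<^sub>m 1\<^sub>m n * (of_real (cmod c) \<cdot>\<^sub>m 1\<^sub>m n) =
        mat_adjoint (c \<cdot>\<^sub>m 1\<^sub>m n) * (c \<cdot>\<^sub>m 1\<^sub>m n)"
      using complex_norm_square[of c] by (simp only: power2_eq_square of_real_mult mult.commute[of "cnj c"])
  qed simp
  then show ?thesis by (simp add: trace_norm_def mat_trace_def)
qed

section \<open>Numerical radius and unital completely positive maps\<close>

text \<open>A real \<open>Sup\<close> bounds the members of a set only if the set is bounded.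
  Coordinates of a unit vector have modulus at most 1, so the sum of the moduli of all entries of T
  serves as a crude bound.\<close>

lemma bdd_above_numerical_radius:
  assumes T: "T \<in> carrier_mat k k"
  shows "bdd_above {cmod ((T *\<^sub>v x) \<bullet>c x) | x. x \<in> carrier_vec (dim_col T) \<and> vec_len x = 1}"
proof (rule bdd_aboveI)
  fix s assume "s \<in> {cmod ((T *\<^sub>v x) \<bullet>c x) | x. x \<in> carrier_vec (dim_col T) \<and> vec_len x = 1}"
  then obtain x where x: "x \<in> carrier_vec k" "x \<bullet>c x = 1" and s: "s = cmod ((T *\<^sub>v x) \<bullet>c x)"
    using T vec_len_eq_1_iff[of _ k] by auto
  have le1: "cmod (x $ i) \<le> 1" if "i < k" for i
  proof -
    have "of_real (\<Sum>i<k. (cmod (x $ i))\<^sup>2) = (1 :: complex)"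
      using x by (simp add: cscalar_prod_sum[of _ k] flip: complex_norm_square)
    then have "(\<Sum>i<k. (cmod (x $ i))\<^sup>2) = 1" using of_real_eq_1_iff by blast
    moreover have "(cmod (x $ i))\<^sup>2 \<le> (\<Sum>i<k. (cmod (x $ i))\<^sup>2)"
      using that by (intro member_le_sum) auto
    ultimately show ?thesis by (simp add: power_le_one_iff abs_square_le_1)
  qed
  have "s = cmod (\<Sum>i<k. (\<Sum>j<k. T $$ (i, j) * x $ j) * cnj (x $ i))"
    unfolding s cscalar_prod_sum[OF x(1)] by (simp add: index_mult_mat_vec_sum[OF T x(1)] del: index_mult_mat_vec)
  also have "\<dots> \<le> (\<Sum>i<k. cmod ((\<Sum>j<k. T $$ (i, j) * x $ j) * cnj (x $ i)))" by (rule norm_sum)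
  also have "\<dots> \<le> (\<Sum>i<k. \<Sum>j<k. cmod (T $$ (i, j)))"
  proof (rule sum_mono)
    fix i assume "i \<in> {..<k}"
    then have "cmod ((\<Sum>j<k. T $$ (i, j) * x $ j) * cnj (x $ i)) \<le> cmod (\<Sum>j<k. T $$ (i, j) * x $ j)"
      using le1[of i] by (simp add: norm_mult mult_left_le)
    also have "\<dots> \<le> (\<Sum>j<k. cmod (T $$ (i, j) * x $ j))" by (rule norm_sum)
    also have "\<dots> \<le> (\<Sum>j<k. cmod (T $$ (i, j)))"
      using le1 by (intro sum_mono) (simp add: norm_mult mult_left_le)
    finally show "cmod ((\<Sum>j<k. T $$ (i, j) * x $ j) * cnj (x $ i)) \<le> (\<Sum>j<k. cmod (T $$ (i, j)))" .
  qed
  finally show "s \<le> (\<Sum>i<k. \<Sum>j<k. cmod (T $$ (i, j)))" .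
qed

text \<open>Both sides scale by |c|^2 when x is replaced by c x, which reduces the claim to unit
  vectors. The homogeneous form is the one needed to test positivity on all vectors.\<close>

lemma cmod_le_numerical_radius:
  assumes T: "T \<in> carrier_mat k k" and x: "x \<in> carrier_vec k"
  shows "cmod ((T *\<^sub>v x) \<bullet>c x) \<le> numerical_radius T * Re (x \<bullet>c x)"
proof (cases "x = 0\<^sub>v k")
  case True
  then show ?thesis using T by simp
next
  case False
  obtain c where c: "c \<noteq> 0" "(c \<cdot>\<^sub>v x) \<bullet>c (c \<cdot>\<^sub>v x) = 1" using obtain_normalized[OF x False] .
  have "(c \<cdot>\<^sub>v x) \<bullet>c (c \<cdot>\<^sub>v x) = of_real ((cmod c)\<^sup>2) * (x \<bullet>c x)"
    unfolding complex_norm_square using x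
    by (simp add: cscalar_prod_smult_left[of _ k] cscalar_prod_smult_right[of _ k])
  then have "of_real ((cmod c)\<^sup>2 * (vec_len x)\<^sup>2) = (1 :: complex)"
    using c(2) cscalar_prod_self[OF x] by simp
  then have xx: "(cmod c)\<^sup>2 * Re (x \<bullet>c x) = 1"
    unfolding of_real_eq_1_iff by (simp add: cscalar_prod_self[OF x])
  have "(T *\<^sub>v (c \<cdot>\<^sub>v x)) \<bullet>c (c \<cdot>\<^sub>v x) = of_real ((cmod c)\<^sup>2) * ((T *\<^sub>v x) \<bullet>c x)"
    unfolding complex_norm_square using T x
    by (simp add: mult_mat_vec[of _ k k] cscalar_prod_smult_left[of _ k]
        cscalar_prod_smult_right[of _ k] mult_mat_vec_carrier[of _ k k])
  then have "cmod ((T *\<^sub>v (c \<cdot>\<^sub>v x)) \<bullet>c (c \<cdot>\<^sub>v x)) = (cmod c)\<^sup>2 * cmod ((T *\<^sub>v x) \<bullet>c x)"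
    by (simp add: norm_mult norm_power)
  moreover have "cmod ((T *\<^sub>v (c \<cdot>\<^sub>v x)) \<bullet>c (c \<cdot>\<^sub>v x)) \<le> numerical_radius T"
    unfolding numerical_radius_def using x c T vec_len_eq_1_iff[of "c \<cdot>\<^sub>v x" k]
    by (intro cSup_upper bdd_above_numerical_radius[OF T]) auto
  ultimately have "(cmod c)\<^sup>2 * cmod ((T *\<^sub>v x) \<bullet>c x) \<le> (cmod c)\<^sup>2 * (numerical_radius T * Re (x \<bullet>c x))"
    using xx by (simp add: mult.left_commute)
  then show ?thesis using c(1) by (simp add: mult_le_cancel_left)
qed

lemma block_mat_1:
  assumes "A \<in> carrier_mat k k"
  shows "block_mat 1 k (\<lambda>i j. A) = A"
  using assms by (intro eq_matI) (auto simp: block_mat_def)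

text \<open>The instance m = 1 of complete positivity, a one-by-one array of blocks being the block
  itself.\<close>

lemma unital_cp_maps_positive:
  assumes T: "T \<in> carrier_mat k k" and \<Phi>: "\<Phi> \<in> unital_cp_maps n T"
    and A: "A \<in> cstar_generated T" "positive_mat k A"
  shows "positive_mat n (\<Phi> A)"
proof -
  have "positive_mat (1 * k) (block_mat 1 k (\<lambda>i j. A))"
    using A(2) block_mat_1[OF positive_matD(1)[OF A(2)]] by simp
  then have "positive_mat (1 * n) (block_mat 1 n (\<lambda>i j. \<Phi> A))"
  proof -
    have "completely_positive k n (cstar_generated T) \<Phi>" using \<Phi> T by (simp add: unital_cp_maps_def)
    then show ?thesis
      unfolding completely_positive_def using A(1) \<open>positive_mat (1 * k) _\<close>
      by (elim allE[of _ 1] allE[of _ "\<lambda>i j. A"]) blast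
  qed
  moreover have "\<Phi> A \<in> carrier_mat n n"
    using \<Phi> A(1) by (auto simp: unital_cp_maps_def linear_map_on_def)
  ultimately show ?thesis using block_mat_1[of "\<Phi> A" n] by simp
qed

lemma cscalar_prod_affine_combination:
  fixes S T :: "complex mat"
  assumes "T \<in> carrier_mat n n" "S \<in> carrier_mat n n" "x \<in> carrier_vec n"
  shows "((w \<cdot>\<^sub>m 1\<^sub>m n + (c \<cdot>\<^sub>m T + d \<cdot>\<^sub>m S)) *\<^sub>v x) \<bullet>c x =
    w * (x \<bullet>c x) + (c * ((T *\<^sub>v x) \<bullet>c x) + d * ((S *\<^sub>v x) \<bullet>c x))"
proof -
  have "(w \<cdot>\<^sub>m 1\<^sub>m n + (c \<cdot>\<^sub>m T + d \<cdot>\<^sub>m S)) *\<^sub>v x = w \<cdot>\<^sub>v x + (c \<cdot>\<^sub>v (T *\<^sub>v x) + d \<cdot>\<^sub>v (S *\<^sub>v x))"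
    using assms by (simp add: add_mult_distrib_mat_vec[of _ n n] smult_mat_mult_vec[of _ n n])
  then show ?thesis
    using assms by (simp add: cscalar_prod_add_left[of _ n] cscalar_prod_smult_left[of _ n] mult_mat_vec_carrier[of _ n n])
qed

text \<open>A unital positive map sends \<open>\<omega>(T) I - Re (u T)\<close>, with \<open>u\<close> unimodular, to a positive matrix.\<close>

lemma unital_cp_map_numerical_range:
  assumes T: "T \<in> carrier_mat k k" and \<Phi>: "\<Phi> \<in> unital_cp_maps n T"
    and x: "x \<in> carrier_vec n" "x \<bullet>c x = 1"
  shows "cmod ((\<Phi> T *\<^sub>v x) \<bullet>c x) \<le> numerical_radius T"
proof -
  define w where "w = numerical_radius T"
  define S where "S = mat_adjoint T"
  note alg = unital_cstar_subalgebra_cstar_generated[OF T, unfolded unital_cstar_subalgebra_def]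
  have S: "S \<in> carrier_mat k k" using T by (simp add: S_def)
  have mem: "T \<in> cstar_generated T" "S \<in> cstar_generated T" "1\<^sub>m k \<in> cstar_generated T"
    using alg by (auto simp: S_def)
  have memp: "\<And>X Y. X \<in> cstar_generated T \<Longrightarrow> Y \<in> cstar_generated T \<Longrightarrow> X + Y \<in> cstar_generated T"
    "\<And>X c. X \<in> cstar_generated T \<Longrightarrow> c \<cdot>\<^sub>m X \<in> cstar_generated T"
    using alg by auto
  have lin: "\<And>X. X \<in> cstar_generated T \<Longrightarrow> \<Phi> X \<in> carrier_mat n n"
    "\<And>X Y. X \<in> cstar_generated T \<Longrightarrow> Y \<in> cstar_generated T \<Longrightarrow> \<Phi> (X + Y) = \<Phi> X + \<Phi> Y"
    "\<And>X c. X \<in> cstar_generated T \<Longrightarrow> \<Phi> (c \<cdot>\<^sub>m X) = c \<cdot>\<^sub>m \<Phi> X"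
    using \<Phi> by (auto simp: unital_cp_maps_def linear_map_on_def)
  have one: "\<Phi> (1\<^sub>m k) = 1\<^sub>m n" using \<Phi> T by (simp add: unital_cp_maps_def)
  define a where "a = (\<Phi> T *\<^sub>v x) \<bullet>c x"
  define b where "b = (\<Phi> S *\<^sub>v x) \<bullet>c x"
  have main: "0 \<le> of_real w - (u * a + cnj u * b) / 2" if u: "cmod u = 1" for u
  proof -
    \<comment> \<open>This is w I - Re (u T), written as a combination of I, T and T* so that
      membership in the algebra and linearity of \<Phi> apply directly.\<close>
    define H where "H = of_real w \<cdot>\<^sub>m 1\<^sub>m k + ((- u / 2) \<cdot>\<^sub>m T + (- cnj u / 2) \<cdot>\<^sub>m S)"
    have "positive_mat k H"
      unfolding positive_mat_def
    proof (intro conjI ballI)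
      show "H \<in> carrier_mat k k" using S T by (simp add: H_def)
      fix y :: "complex vec" assume y: "y \<in> carrier_vec k"
      define t where "t = (T *\<^sub>v y) \<bullet>c y"
      have "(S *\<^sub>v y) \<bullet>c y = cnj t"
        using cscalar_prod_adjoint[OF S y y] cscalar_prod_commute[of "T *\<^sub>v y" k y] T y
        by (simp add: S_def t_def)
      then have "(H *\<^sub>v y) \<bullet>c y = of_real w * (y \<bullet>c y) + (- u / 2 * t + - cnj u / 2 * cnj t)"
        unfolding H_def cscalar_prod_affine_combination[OF T S y] by (simp add: t_def)
      also have "\<dots> = of_real (w * Re (y \<bullet>c y) - Re (u * t))"
        by (simp add: cscalar_prod_self[OF y] complex_eq_iff field_simps)
      also have "\<dots> \<ge> 0"
      proof -
        have "Re (u * t) \<le> cmod (u * t)" by (rule complex_Re_le_cmod)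
        also have "\<dots> \<le> w * Re (y \<bullet>c y)"
          using cmod_le_numerical_radius[OF T y] u by (simp add: norm_mult t_def w_def)
        finally show ?thesis by (simp add: less_eq_complex_def)
      qed
      finally show "0 \<le> (H *\<^sub>v y) \<bullet>c y" .
    qed
    moreover have "H \<in> cstar_generated T"
      unfolding H_def by (intro memp mem)
    ultimately have "positive_mat n (\<Phi> H)" using unital_cp_maps_positive[OF T \<Phi>] by simp
    moreover have "\<Phi> H = of_real w \<cdot>\<^sub>m 1\<^sub>m n + ((- u / 2) \<cdot>\<^sub>m \<Phi> T + (- cnj u / 2) \<cdot>\<^sub>m \<Phi> S)"
      unfolding H_def by (simp add: lin memp mem one)
    ultimately have "0 \<le> of_real w * (x \<bullet>c x) + (- u / 2 * a + - cnj u / 2 * b)"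
      using positive_matD(2)[of n "\<Phi> H" x] x(1)
        cscalar_prod_affine_combination[OF lin(1)[OF mem(1)] lin(1)[OF mem(2)] x(1)]
      by (simp add: a_def b_def)
    then show ?thesis using x(2) by (simp add: field_simps)
  qed
  \<comment> \<open>Compatibility of \<Phi> with adjoints is read off from positivity: that the
    expression in \<open>main\<close> is real at u = 1 gives Im a = - Im b, and at u = \<i> gives Re
    a = Re b.\<close>
  have b: "b = cnj a"
    using main[of 1] main[of \<i>] by (auto simp: less_eq_complex_def complex_eq_iff)
  show ?thesis
  proof (cases "a = 0")
    case True
    have "0 \<le> w" using main[of 1] b True by (simp add: less_eq_complex_def)
    then show ?thesis using True by (simp add: a_def w_def)
  next
    case False
    \<comment> \<open>This phase turns a onto the positive real axis, where the half-plane condition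
      reads |a| \<le> w.\<close>
    define u where "u = cnj a / of_real (cmod a)"
    have u: "cmod u = 1" using False by (simp add: u_def norm_divide)
    have "u * a = of_real (cmod a)"
      using False by (simp add: u_def complex_norm_square[symmetric] mult.commute[of "cnj a"] power2_eq_square)
    moreover then have "cnj u * b = of_real (cmod a)"
      unfolding b by (metis complex_cnj_complex_of_real complex_cnj_mult)
    ultimately show ?thesis
      using main[OF u] by (simp add: less_eq_complex_def a_def w_def)
  qed
qed

section \<open>Block quadratic forms and vector states\<close>

lemma sum_lessThan_mult:
  fixes f :: "nat \<Rightarrow> 'a :: comm_monoid_add"
  shows "(\<Sum>r<m * k. f r) = (\<Sum>i<m. \<Sum>a<k. f (i * k + a))"
proof (induction m)
  case (Suc m)
  have "(\<Sum>r<Suc m * k. f r) = (\<Sum>r<m * k + k. f r)" by (simp add: add.commute)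
  with Suc show ?case by (simp add: sum_lessThan_add)
qed simp

lemma block_index_less:
  fixes i k a m :: nat
  assumes "i < m" "a < k"
  shows "i * k + a < m * k"
proof -
  have "i * k + a < Suc i * k" using assms by simp
  also have "\<dots> \<le> m * k" using assms by (intro mult_le_mono1) simp
  finally show ?thesis .
qed

text \<open>Writing r = i k + a splits each index into block and offset, which resolves the
  \<open>div\<close> and \<open>mod\<close> of \<open>block_mat\<close>.\<close>

lemma cscalar_prod_block_mat:
  assumes "y \<in> carrier_vec (m * k)"
  shows "(block_mat m k B *\<^sub>v y) \<bullet>c y =
    (\<Sum>i<m. \<Sum>a<k. (\<Sum>j<m. \<Sum>b<k. B i j $$ (a, b) * y $ (j * k + b)) * cnj (y $ (i * k + a)))"
proof -
  have M: "block_mat m k B \<in> carrier_mat (m * k) (m * k)" by (simp add: block_mat_def)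
  have "(block_mat m k B *\<^sub>v y) \<bullet>c y =
    (\<Sum>r<m * k. (\<Sum>s<m * k. block_mat m k B $$ (r, s) * y $ s) * cnj (y $ r))"
    by (simp add: cscalar_prod_sum[OF assms] index_mult_mat_vec_sum[OF M assms] del: index_mult_mat_vec)
  also have "\<dots> = (\<Sum>i<m. \<Sum>a<k. (\<Sum>j<m. \<Sum>b<k. B i j $$ (a, b) * y $ (j * k + b)) * cnj (y $ (i * k + a)))"
    unfolding sum_lessThan_mult using block_index_less by (intro sum.cong refl arg_cong2[of _ _ _ _ "(*)"]) (auto simp: block_mat_def)
  finally show ?thesis .
qed

text \<open>Tensoring with x reduces positivity of the image to that of the given array: the form of
  the image at y is the sum over p < n of the forms of the array at z_p, the tensor product of x
  with the vector in \<complex>\<open>\<^sup>m\<close> that collects coordinate p of every block of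
  y.\<close>

lemma vector_state_unital_cp_map:
  assumes T: "T \<in> carrier_mat k k" and x: "x \<in> carrier_vec k" "x \<bullet>c x = 1"
  shows "(\<lambda>A. ((A *\<^sub>v x) \<bullet>c x) \<cdot>\<^sub>m 1\<^sub>m n) \<in> unital_cp_maps n T"
proof -
  define \<phi> where "\<phi> = (\<lambda>A. (A *\<^sub>v x) \<bullet>c x)"
  have sub: "cstar_generated T \<subseteq> carrier_mat k k"
    using unital_cstar_subalgebra_cstar_generated(1)[OF T] by (simp add: unital_cstar_subalgebra_def)
  have add: "\<phi> (X + Y) = \<phi> X + \<phi> Y" if "X \<in> carrier_mat k k" "Y \<in> carrier_mat k k" for X Y
    using that x
    by (simp add: \<phi>_def add_mult_distrib_mat_vec[of _ k k] cscalar_prod_add_left[of _ k] mult_mat_vec_carrier[of _ k k])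
  have smult: "\<phi> (c \<cdot>\<^sub>m X) = c * \<phi> X" if "X \<in> carrier_mat k k" for X c
    using that x
    by (simp add: \<phi>_def smult_mat_mult_vec[of _ k k] cscalar_prod_smult_left[of _ k] mult_mat_vec_carrier[of _ k k])
  have \<phi>_sum: "\<phi> X = (\<Sum>a<k. (\<Sum>b<k. X $$ (a, b) * x $ b) * cnj (x $ a))" if "X \<in> carrier_mat k k" for X
    using that x by (simp add: \<phi>_def cscalar_prod_sum[of _ k] index_mult_mat_vec_sum[of _ k k] del: index_mult_mat_vec)
  have "linear_map_on n (cstar_generated T) (\<lambda>A. \<phi> A \<cdot>\<^sub>m 1\<^sub>m n)"
    unfolding linear_map_on_def using sub add smult
    by (auto simp: subset_iff algebra_simps intro!: eq_matI)
  moreover have "\<phi> (1\<^sub>m k) \<cdot>\<^sub>m 1\<^sub>m n = 1\<^sub>m n" using x by (auto simp: \<phi>_def intro!: eq_matI)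
  moreover have "completely_positive k n (cstar_generated T) (\<lambda>A. \<phi> A \<cdot>\<^sub>m 1\<^sub>m n)"
    unfolding completely_positive_def
  proof (intro allI impI)
    fix m B assume "(\<forall>i<m. \<forall>j<m. B i j \<in> cstar_generated T) \<and> positive_mat (m * k) (block_mat m k B)"
    then have B: "\<And>i j. i < m \<Longrightarrow> j < m \<Longrightarrow> B i j \<in> carrier_mat k k"
      and pos: "positive_mat (m * k) (block_mat m k B)" using sub by auto
    show "positive_mat (m * n) (block_mat m n (\<lambda>i j. \<phi> (B i j) \<cdot>\<^sub>m 1\<^sub>m n))"
      unfolding positive_mat_def
    proof (intro conjI ballI)
      fix y :: "complex vec" assume y: "y \<in> carrier_vec (m * n)"
      define z where "z = (\<lambda>p. vec (m * k) (\<lambda>r. y $ ((r div k) * n + p) * x $ (r mod k)))"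
      have zc: "z p \<in> carrier_vec (m * k)" for p by (simp add: z_def)
      have zi: "z p $ (i * k + a) = y $ (i * n + p) * x $ a" if "i < m" "a < k" for p i a
        using block_index_less[OF that] that by (simp add: z_def)
      have "(block_mat m n (\<lambda>i j. \<phi> (B i j) \<cdot>\<^sub>m 1\<^sub>m n) *\<^sub>v y) \<bullet>c y =
        (\<Sum>i<m. \<Sum>p<n. (\<Sum>j<m. \<Sum>q<n. (\<phi> (B i j) \<cdot>\<^sub>m 1\<^sub>m n) $$ (p, q) * y $ (j * n + q)) * cnj (y $ (i * n + p)))"
        by (rule cscalar_prod_block_mat[OF y])
      also have "\<dots> = (\<Sum>i<m. \<Sum>p<n. (\<Sum>j<m. \<phi> (B i j) * y $ (j * n + p)) * cnj (y $ (i * n + p)))"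
      proof (intro sum.cong refl arg_cong2[of _ _ _ _ "(*)"])
        fix i p j assume "p \<in> {..<n}"
        then have "(\<Sum>q<n. (\<phi> (B i j) \<cdot>\<^sub>m 1\<^sub>m n) $$ (p, q) * y $ (j * n + q)) =
            (\<Sum>q<n. if q = p then \<phi> (B i j) * y $ (j * n + q) else 0)"
          by (intro sum.cong) auto
        then show "(\<Sum>q<n. (\<phi> (B i j) \<cdot>\<^sub>m 1\<^sub>m n) $$ (p, q) * y $ (j * n + q)) = \<phi> (B i j) * y $ (j * n + p)"
          using \<open>p \<in> {..<n}\<close> by simp
      qed
      also have "\<dots> = (\<Sum>p<n. \<Sum>i<m. (\<Sum>j<m. \<phi> (B i j) * y $ (j * n + p)) * cnj (y $ (i * n + p)))"
        by (rule sum.swap)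
      also have "\<dots> = (\<Sum>p<n. (block_mat m k B *\<^sub>v z p) \<bullet>c z p)"
      proof (rule sum.cong[OF refl])
        fix p
        have "(block_mat m k B *\<^sub>v z p) \<bullet>c z p =
          (\<Sum>i<m. \<Sum>a<k. (\<Sum>j<m. \<Sum>b<k. B i j $$ (a, b) * (y $ (j * n + p) * x $ b)) * cnj (y $ (i * n + p) * x $ a))"
          unfolding cscalar_prod_block_mat[OF zc] using zi by simp
        also have "\<dots> = (\<Sum>i<m. \<Sum>a<k. \<Sum>j<m. (\<Sum>b<k. B i j $$ (a, b) * x $ b) * cnj (x $ a) * y $ (j * n + p) * cnj (y $ (i * n + p)))"
          by (simp add: sum_distrib_right sum_distrib_left mult_ac)
        \<comment> \<open>Moving the sum over a inside the one over j isolates the double sum over a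
          and b, which is the state evaluated at the block B i j.\<close>
        also have "\<dots> = (\<Sum>i<m. \<Sum>j<m. \<Sum>a<k. (\<Sum>b<k. B i j $$ (a, b) * x $ b) * cnj (x $ a) * y $ (j * n + p) * cnj (y $ (i * n + p)))"
          by (intro sum.cong refl sum.swap)
        also have "\<dots> = (\<Sum>i<m. (\<Sum>j<m. \<phi> (B i j) * y $ (j * n + p)) * cnj (y $ (i * n + p)))"
          using B by (simp add: \<phi>_sum flip: sum_distrib_right)
        finally show "(\<Sum>i<m. (\<Sum>j<m. \<phi> (B i j) * y $ (j * n + p)) * cnj (y $ (i * n + p))) =
            (block_mat m k B *\<^sub>v z p) \<bullet>c z p" ..
      qed
      also have "\<dots> \<ge> 0"
        using positive_matD(2)[OF pos zc] by (intro sum_nonneg) auto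
      finally show "0 \<le> (block_mat m n (\<lambda>i j. \<phi> (B i j) \<cdot>\<^sub>m 1\<^sub>m n) *\<^sub>v y) \<bullet>c y" .
    qed (simp add: block_mat_def)
  qed
  ultimately show ?thesis using T by (simp add: unital_cp_maps_def \<phi>_def)
qed

section \<open>Comparison of the two suprema\<close>

theorem theorem3p7:
  fixes T :: "complex mat" and k n :: nat
  assumes "k > 0" and "T \<in> carrier_mat k k" and "n > 0"
  shows "numerical_radius T = (1 / real n) * matricial_radius n T"
proof -
  note T = assms(2)
  define R where "R = {trace_norm X | X. X \<in> matricial_range n T}"
  have ub: "s \<le> real n * numerical_radius T" if "s \<in> R" for s
  proof -
    from that obtain \<Phi> where \<Phi>: "\<Phi> \<in> unital_cp_maps n T" and s: "s = trace_norm (\<Phi> T)"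
      by (auto simp: R_def matricial_range_def)
    have "\<Phi> T \<in> carrier_mat n n"
      using \<Phi> unital_cstar_subalgebra_cstar_generated(2)[OF T]
      by (auto simp: unital_cp_maps_def linear_map_on_def)
    then show ?thesis
      unfolding s using unital_cp_map_numerical_range[OF T \<Phi>] by (rule trace_norm_le)
  qed
  have lb: "real n * cmod ((T *\<^sub>v x) \<bullet>c x) \<in> R" if "x \<in> carrier_vec k" "vec_len x = 1" for x
  proof -
    have "((T *\<^sub>v x) \<bullet>c x) \<cdot>\<^sub>m 1\<^sub>m n \<in> matricial_range n T"
      using vector_state_unital_cp_map[OF T that(1), of n] that(2) vec_len_eq_1_iff[OF that(1)]
      unfolding matricial_range_def
      by (intro CollectI exI[of _ "\<lambda>A. ((A *\<^sub>v x) \<bullet>c x) \<cdot>\<^sub>m 1\<^sub>m n"]) simp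
    then show ?thesis
      unfolding R_def by (metis (mono_tags, lifting) mem_Collect_eq trace_norm_smult_one)
  qed
  \<comment> \<open>Here k > 0 enters: a unit vector exists, so both suprema range over nonempty
    sets.\<close>
  have unit: "unit_vec k 0 \<in> carrier_vec k" "vec_len (unit_vec k 0) = 1"
    using assms(1) vec_len_eq_1_iff[of "unit_vec k 0" k] by (auto simp: cscalar_prod_unit_vec)
  have "Sup R \<le> real n * numerical_radius T"
    using lb[OF unit] ub by (intro cSup_least) auto
  moreover have "numerical_radius T \<le> Sup R / real n"
    unfolding numerical_radius_def
  proof (rule cSup_least)
    show "{cmod ((T *\<^sub>v x) \<bullet>c x) | x. x \<in> carrier_vec (dim_col T) \<and> vec_len x = 1} \<noteq> {}"
      using unit carrier_matD(2)[OF T] by blast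
    fix s assume "s \<in> {cmod ((T *\<^sub>v x) \<bullet>c x) | x. x \<in> carrier_vec (dim_col T) \<and> vec_len x = 1}"
    then obtain x where x: "x \<in> carrier_vec k" "vec_len x = 1" and s: "s = cmod ((T *\<^sub>v x) \<bullet>c x)"
      using T by auto
    \<comment> \<open>The bound \<open>ub\<close> also provides the boundedness of \<open>R\<close>
      under which \<open>Sup R\<close> dominates its members.\<close>
    have "real n * s \<le> Sup R"
      unfolding s using lb[OF x] ub by (intro cSup_upper bdd_aboveI) auto
    then show "s \<le> Sup R / real n" using assms(3) by (simp add: field_simps)
  qed
  ultimately show ?thesis
    using assms(3) by (simp add: matricial_radius_def R_def[symmetric] field_simps)
qed

end
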